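(* Let $m,n\ge 2$, let $(X,d)$ be a (nonempty) compact metric space and let $\mathcal S=(X,(\phi_j)_{j=0,\dots,n-1},(p_j)_{j=0,\dots,n-1})$ be a GIFSpdp of degree $m$ satisfying the following two hypotheses. (E1) For each $j$ there are $a_{j,0},\dots,a_{j,m-1}>0$ with $\sum_{k}a_{j,k}<1$ such that $d(\phi_j(x),\phi_j(y))\le\sum_{k=0}^{m-1}a_{j,k}\,d(x_k,y_k)$ for all $x,y\in X^m$. (E2) There is $\delta>0$ such that $p_j(x)\ge\delta$ for all $j$ and all $x\in X^m$. Moreover, for each $j$ there are $c_{j,0},\dots,c_{j,m-1}>0$ with $\sum_k c_{j,k}<1$ such that $|p_j(x)-p_j(y)|\le\sum_{k=0}^{m-1}c_{j,k}\,d(x_k,y_k)$ for all $x,y\in X^m$. Let $\alpha\in \mathrm{Prob}(X^m)$ be the extended Hutchinson measure of $\mathcal S$. Then all $m$ one-dimensional marginals of $\alpha$ coincide. Write $\mu_\alpha=(\Pi_{0})_*\alpha=\cdots=(\Pi_{m-1})_*\alpha$ (the projected Hutchinson measure), where $\Pi_k:X^m\to X$ is the projection onto the $k$-th coordinate. For each $(x_0,\dots,x_{m-1})\in X^m$ there exists a measurable set $\Omega_{(x_0,\dots,x_{m-1})}\subseteq\Omega=\{0,\dots,n-1\}^{\mathbb N}$ with $P_{(x_0,\dots,x_{m-1})}(\Omega_{(x_0,\dots,x_{m-1})})=1$ such that for every $w\in\Omega_{(x_0,\dots,x_{m-1})}$ and every $f\in C(X,\mathbb R)$, $$\lim_{K\to\infty}\frac1K\big(f(x_0(w))+f(x_1(w))+\cdots+f(x_{K-1}(w))\big)=\int_X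 f\,d\mu_\alpha .$$
   Context: $X^m$ carries the metric $d_\infty(x,y)=\max_k d(x_k,y_k)$, points are written $x=(x_0,\dots,x_{m-1})$, and $\mathrm{Prob}(Y)$ denotes the regular Borel probability measures on $Y$. A generalized iterated function system with place dependent probabilities (GIFSpdp) of degree $m$ with $n$ maps is a family of continuous maps $\phi_j:X^m\to X$ together with weight functions $p_j:X^m\to[0,1]$, $j=0,\dots,n-1$, such that $\sum_j p_j(x)=1$ for all $x\in X^m$. Its extension is the system of maps $\hat\phi_j:X^m\to X^m$, $\hat\phi_j(x_0,\dots,x_{m-1})=(x_1,\dots,x_{m-1},\phi_j(x_0,\dots,x_{m-1}))$, with the same weights $p_j$. Put $B_{\hat{\mathcal S}}(g)(x)=\sum_{j}p_j(x)\,g(\hat\phi_j(x))$ for $g\in C(X^m,\mathbb R)$, and define $\mathcal L_{\hat{\mathcal S}}:\mathrm{Prob}(X^m)\to\mathrm{Prob}(X^m)$ by $\int g\,d\mathcal L_{\hat{\mathcal S}}(\alpha)=\int B_{\hat{\mathcal S}}(g)\,d\alpha$ for all $g\in C(X^m,\mathbb R)$. Under (E1) and (E2), $\mathcal L_{\hat{\mathcal S}}$ has a unique fixed point $\alpha$, called the extended Hutchinson measure of $\mathcal S$. Orbit: for $w=(w_0,w_1,\dots)\in\Omega$ and $(x_0,\dots,x_{m-1})\in X^m$, set $x_k(w)=x_k$ for $0\le k\le m-1$ and $x_{j+m}(w)=\phi_{w_j}(x_j(w),\dots,x_{j+m-1}(w))$ for $j\ge0$. $P_{(x_0,\dots,x_{m-1})}$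 is the Borel probability measure on $\Omega$ (product topology) determined by its values on cylinders, $$P_{(x_0,\dots,x_{m-1})}(\{v\in\Omega: v_0=w_0,\dots,v_{N-1}=w_{N-1}\})=\prod_{j=0}^{N-1}p_{w_j}(x_j(w),\dots,x_{j+m-1}(w)).$$ *)

theory Defs
  imports "HOL-Probability.Probability"
begin

text \<open>The metric space \<open>X\<close> is a type of class \<open>metric_space\<close>. Points of \<open>X^m\<close> are the functions
  on \<open>{..<m}\<close> that are extensional, i.e. \<open>undefined\<close> outside \<open>{..<m}\<close>.\<close>

definition pow_space :: "nat \<Rightarrow> (nat \<Rightarrow> 'a) set" where
  "pow_space m = (\<Pi>\<^sub>E i\<in>{..<m}. UNIV)"

definition d_inf :: "nat \<Rightarrow> (nat \<Rightarrow> 'a::metric_space) \<Rightarrow> (nat \<Rightarrow> 'a) \<Rightarrow> real" where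
  "d_inf m x y = Max ((\<lambda>k. dist (x k) (y k)) ` {..<m})"

lemma Metric_space_d_inf:
  assumes "m > 0"
  shows "Metric_space (pow_space m :: (nat \<Rightarrow> 'a::metric_space) set) (d_inf m)"
proof
  have ne: "(\<lambda>k. dist (x k) (y k)) ` {..<m} \<noteq> {}" for x y :: "nat \<Rightarrow> 'a"
    using assms by auto
  have ge: "dist (x k) (y k) \<le> d_inf m x y" if "k < m" for x y :: "nat \<Rightarrow> 'a" and k
    unfolding d_inf_def using that by (intro Max_ge) auto
  have le: "d_inf m x y \<le> c" if "\<And>k. k < m \<Longrightarrow> dist (x k) (y k) \<le> c" for x y :: "nat \<Rightarrow> 'a" and c
    unfolding d_inf_def using that ne by (subst Max_le_iff) auto
  fix x y z :: "nat \<Rightarrow> 'a"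
  show "0 \<le> d_inf m x y"
    using ge[of 0 x y] assms zero_le_dist[of "x 0" "y 0"] by linarith
  show "d_inf m x y = d_inf m y x"
    by (simp add: d_inf_def dist_commute)
  show "d_inf m x y = 0 \<longleftrightarrow> x = y" if "x \<in> pow_space m" "y \<in> pow_space m"
  proof
    assume 0: "d_inf m x y = 0"
    show "x = y"
    proof (rule PiE_ext)
      show "x \<in> (\<Pi>\<^sub>E i\<in>{..<m}. UNIV)" "y \<in> (\<Pi>\<^sub>E i\<in>{..<m}. UNIV)"
        using that by (simp_all add: pow_space_def)
      show "x k = y k" if "k \<in> {..<m}" for k
        using ge[of k x y] that 0 by simp
    qed
  next
    assume "x = y"
    then show "d_inf m x y = 0"
      using le[of x y 0] \<open>0 \<le> d_inf m x y\<close> by simp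
  qed
  show "d_inf m x z \<le> d_inf m x y + d_inf m y z"
  proof (rule le)
    fix k assume "k < m"
    have "dist (x k) (z k) \<le> dist (x k) (y k) + dist (y k) (z k)"
      by (rule dist_triangle)
    also have "\<dots> \<le> d_inf m x y + d_inf m y z"
      using \<open>k < m\<close> by (intro add_mono ge)
    finally show "dist (x k) (z k) \<le> d_inf m x y + d_inf m y z" .
  qed
qed

definition pow_topology :: "nat \<Rightarrow> (nat \<Rightarrow> 'a::metric_space) topology" where
  "pow_topology m = Metric_space.mtopology (pow_space m) (d_inf m)"

definition borel_of :: "'b topology \<Rightarrow> 'b measure" where
  "borel_of T = sigma (topspace T) {U. openin T U}"

definition regular_measure :: "'b topology \<Rightarrow> 'b measure \<Rightarrow> bool" where
  "regular_measure T M \<longleftrightarrow>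
     (\<forall>A\<in>sets M.
        emeasure M A = (SUP K\<in>{K\<in>sets M. compactin T K \<and> K \<subseteq> A}. emeasure M K) \<and>
        emeasure M A = (INF U\<in>{U. openin T U \<and> A \<subseteq> U}. emeasure M U))"

definition Prob :: "'b topology \<Rightarrow> 'b measure set" where
  "Prob T = {M. prob_space M \<and> sets M = sets (borel_of T) \<and> regular_measure T M}"

definition gifspdp ::
  "nat \<Rightarrow> nat \<Rightarrow> (nat \<Rightarrow> (nat \<Rightarrow> 'a::metric_space) \<Rightarrow> 'a) \<Rightarrow> (nat \<Rightarrow> (nat \<Rightarrow> 'a) \<Rightarrow> real) \<Rightarrow> bool" where
  "gifspdp m n \<phi> p \<longleftrightarrow>
     (\<forall>j<n. continuous_map (pow_topology m) euclidean (\<phi> j)) \<and>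
     (\<forall>j<n. \<forall>x\<in>pow_space m. p j x \<in> {0..1}) \<and>
     (\<forall>x\<in>pow_space m. (\<Sum>j<n. p j x) = 1)"

definition E1 :: "nat \<Rightarrow> nat \<Rightarrow> (nat \<Rightarrow> (nat \<Rightarrow> 'a::metric_space) \<Rightarrow> 'a) \<Rightarrow> bool" where
  "E1 m n \<phi> \<longleftrightarrow>
     (\<forall>j<n. \<exists>a :: nat \<Rightarrow> real. (\<forall>k<m. a k > 0) \<and> (\<Sum>k<m. a k) < 1 \<and>
        (\<forall>x\<in>pow_space m. \<forall>y\<in>pow_space m.
           dist (\<phi> j x) (\<phi> j y) \<le> (\<Sum>k<m. a k * dist (x k) (y k))))"

definition E2 :: "nat \<Rightarrow> nat \<Rightarrow> (nat \<Rightarrow> (nat \<Rightarrow> 'a::metric_space) \<Rightarrow> real) \<Rightarrow> bool" where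
  "E2 m n p \<longleftrightarrow>
     (\<exists>\<delta>>0. \<forall>j<n. \<forall>x\<in>pow_space m. p j x \<ge> \<delta>) \<and>
     (\<forall>j<n. \<exists>c :: nat \<Rightarrow> real. (\<forall>k<m. c k > 0) \<and> (\<Sum>k<m. c k) < 1 \<and>
        (\<forall>x\<in>pow_space m. \<forall>y\<in>pow_space m.
           \<bar>p j x - p j y\<bar> \<le> (\<Sum>k<m. c k * dist (x k) (y k))))"

definition extension :: "nat \<Rightarrow> ((nat \<Rightarrow> 'a) \<Rightarrow> 'a) \<Rightarrow> (nat \<Rightarrow> 'a) \<Rightarrow> (nat \<Rightarrow> 'a)" where
  "extension m h x = (\<lambda>i\<in>{..<m}. if i = m - 1 then h x else x (Suc i))"

definition transfer_op ::
  "nat \<Rightarrow> nat \<Rightarrow> (nat \<Rightarrow> (nat \<Rightarrow> 'a) \<Rightarrow> 'a) \<Rightarrow> (nat \<Rightarrow> (nat \<Rightarrow> 'a) \<Rightarrow> real) \<Rightarrow>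
   ((nat \<Rightarrow> 'a) \<Rightarrow> real) \<Rightarrow> (nat \<Rightarrow> 'a) \<Rightarrow> real" where
  "transfer_op m n \<phi> p g x = (\<Sum>j<n. p j x * g (extension m (\<phi> j) x))"

definition markov_op ::
  "nat \<Rightarrow> nat \<Rightarrow> (nat \<Rightarrow> (nat \<Rightarrow> 'a::metric_space) \<Rightarrow> 'a) \<Rightarrow> (nat \<Rightarrow> (nat \<Rightarrow> 'a) \<Rightarrow> real) \<Rightarrow>
   (nat \<Rightarrow> 'a) measure \<Rightarrow> (nat \<Rightarrow> 'a) measure" where
  "markov_op m n \<phi> p \<alpha> =
     (THE \<beta>. \<beta> \<in> Prob (pow_topology m) \<and>
        (\<forall>g :: (nat \<Rightarrow> 'a) \<Rightarrow> real. continuous_map (pow_topology m) euclideanreal g \<longrightarrow>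
           (\<integral>x. g x \<partial>\<beta>) = (\<integral>x. transfer_op m n \<phi> p g x \<partial>\<alpha>)))"

text \<open>Only the fixed point property is required here; under \<open>E1\<close> and \<open>E2\<close> such a measure exists and
  is unique.\<close>

definition extended_hutchinson_measure ::
  "nat \<Rightarrow> nat \<Rightarrow> (nat \<Rightarrow> (nat \<Rightarrow> 'a::metric_space) \<Rightarrow> 'a) \<Rightarrow> (nat \<Rightarrow> (nat \<Rightarrow> 'a) \<Rightarrow> real) \<Rightarrow>
   (nat \<Rightarrow> 'a) measure \<Rightarrow> bool" where
  "extended_hutchinson_measure m n \<phi> p \<alpha> \<longleftrightarrow>
     \<alpha> \<in> Prob (pow_topology m) \<and> markov_op m n \<phi> p \<alpha> = \<alpha>"

definition marginal :: "nat \<Rightarrow> (nat \<Rightarrow> 'a::metric_space) measure \<Rightarrow> 'a measure" where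
  "marginal k \<alpha> = distr \<alpha> borel (\<lambda>x. x k)"

lemma restrict_fundef_cong [fundef_cong]:
  "A = B \<Longrightarrow> (\<And>i. i \<in> B \<Longrightarrow> f i = g i) \<Longrightarrow> restrict f A = restrict g B"
  by (auto simp: restrict_def)

fun orbit ::
  "nat \<Rightarrow> (nat \<Rightarrow> (nat \<Rightarrow> 'a) \<Rightarrow> 'a) \<Rightarrow> (nat \<Rightarrow> 'a) \<Rightarrow> (nat \<Rightarrow> nat) \<Rightarrow> nat \<Rightarrow> 'a" where
  "orbit m \<phi> x w k =
     (if k < m then x k
      else \<phi> (w (k - m)) (\<lambda>i\<in>{..<m}. orbit m \<phi> x w (k - m + i)))"

declare orbit.simps [simp del]

definition orbit_window ::
  "nat \<Rightarrow> (nat \<Rightarrow> (nat \<Rightarrow> 'a) \<Rightarrow> 'a) \<Rightarrow> (nat \<Rightarrow> 'a) \<Rightarrow> (nat \<Rightarrow> nat) \<Rightarrow> nat \<Rightarrow> (nat \<Rightarrow> 'a)" where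
  "orbit_window m \<phi> x w j = (\<lambda>i\<in>{..<m}. orbit m \<phi> x w (j + i))"

definition code_topology :: "nat \<Rightarrow> (nat \<Rightarrow> nat) topology" where
  "code_topology n = product_topology (\<lambda>_. discrete_topology {..<n}) UNIV"

definition code_measure ::
  "nat \<Rightarrow> nat \<Rightarrow> (nat \<Rightarrow> (nat \<Rightarrow> 'a) \<Rightarrow> 'a) \<Rightarrow> (nat \<Rightarrow> (nat \<Rightarrow> 'a) \<Rightarrow> real) \<Rightarrow>
   (nat \<Rightarrow> 'a) \<Rightarrow> (nat \<Rightarrow> nat) measure" where
  "code_measure m n \<phi> p x =
     (THE P. prob_space P \<and> sets P = sets (borel_of (code_topology n)) \<and>
        (\<forall>N. \<forall>w\<in>topspace (code_topology n).
           measure P {v \<in> topspace (code_topology n). \<forall>i<N. v i = w i} =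
             (\<Prod>j<N. p (w j) (orbit_window m \<phi> x w j))))"

end

theory Submission
  imports Defs "HOL-Library.Discrete_Functions"
begin

text \<open>
  The windows \<open>Y\<^sub>k = (x\<^sub>k, \<dots>, x\<^bsub>k+m-1\<^esub>)\<close> of an orbit form a Markov chain on \<open>X\<^sup>m\<close>: given the past, \<open>Y\<^sub>k\<close>
  moves to its image under the extended map number \<open>j\<close> with probability \<open>p j (Y\<^sub>k)\<close>. Its transition
  operator \<open>B\<close> is the transfer operator, and the extended Hutchinson measure \<open>\<alpha>\<close> is an invariant law.
  The assertion is a strong law of large numbers for this chain from every starting point.

  For a Lipschitz function \<open>g\<close> the iterates \<open>B\<^sup>N g\<close> flatten out uniformly. The extended maps contract a
  suitably weighted maximum metric, so all iterates have a common Lipschitz constant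
  (\<open>avg_op_iterates_equilipschitz\<close>). Since the weights are bounded below, two chains with different
  starting points apply the same long word of maps with a positive probability, and then come close;
  hence the oscillation of \<open>B\<^sup>N g\<close> tends to zero (\<open>avg_op_iterates_flatten\<close>). As \<open>\<alpha>\<close> is invariant, the
  constant in the limit is \<open>\<integral>g d\<alpha>\<close>.

  On the other hand, \<open>g (Y\<^bsub>k+1\<^esub>) - (B g) (Y\<^sub>k)\<close> is bounded and orthogonal to everything that the first
  \<open>k\<close> digits determine, so by a second moment argument its averages vanish almost surely
  (\<open>averages_of_orthogonal_tendsto_zero\<close>). Iterating this, \<open>g\<close> and \<open>B\<^sup>N g\<close> have the same averages
  along almost every trajectory, for every \<open>N\<close>, and those of \<open>B\<^sup>N g\<close> are as close to \<open>\<integral>g d\<alpha>\<close> as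
  desired (\<open>chain_averages_tendsto\<close>). Countably many Lipschitz functions of the first coordinate suffice
  to handle all continuous functions on \<open>X\<close> outside a single null set
  (\<open>countable_lipschitz_test_functions\<close>).

  The Markov operator on measures and the code measure are given by definite descriptions, so both
  need existence and uniqueness. The former is realised as the image of \<open>\<alpha>\<close> under the random maps
  (\<open>markov_op_eq_push\<close>); testing its invariance with functions of a single coordinate shows that
  all marginals agree. The latter comes from the theorem of Ionescu Tulcea (\<open>ex_is_code_measure\<close>).
\<close>

section \<open>Averaging operators of random maps\<close>

locale random_maps =
  fixes S :: "'y set" and n :: nat and T :: "nat \<Rightarrow> 'y \<Rightarrow> 'y" and p :: "nat \<Rightarrow> 'y \<Rightarrow> real"
  assumes maps_into: "\<lbrakk>j < n; y \<in> S\<rbrakk> \<Longrightarrow> T j y \<in> S"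
    and weight_nonneg: "\<lbrakk>j < n; y \<in> S\<rbrakk> \<Longrightarrow> 0 \<le> p j y"
    and weight_sum: "y \<in> S \<Longrightarrow> (\<Sum>j<n. p j y) = 1"
begin

definition avg_op :: "('y \<Rightarrow> real) \<Rightarrow> 'y \<Rightarrow> real" where
  "avg_op g y = (\<Sum>j<n. p j y * g (T j y))"

lemma avg_op_bounded:
  assumes g: "\<And>y. y \<in> S \<Longrightarrow> \<bar>g y\<bar> \<le> G" and y: "y \<in> S"
  shows "\<bar>avg_op g y\<bar> \<le> G"
proof -
  have "\<bar>avg_op g y\<bar> \<le> (\<Sum>j<n. p j y * G)"
    unfolding avg_op_def
    by (rule sum_abs[THEN order_trans], rule sum_mono)
       (auto simp: abs_mult weight_nonneg y intro!: mult_left_mono g maps_into)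
  also have "\<dots> = G"
    using weight_sum[OF y] by (simp flip: sum_distrib_right)
  finally show ?thesis .
qed

lemma avg_op_iterate_bounded:
  assumes "\<And>y. y \<in> S \<Longrightarrow> \<bar>g y\<bar> \<le> G" and "y \<in> S"
  shows "\<bar>(avg_op ^^ N) g y\<bar> \<le> G"
  using assms(2) by (induction N arbitrary: y) (auto intro: assms(1) avg_op_bounded)

text \<open>Choosing the maps at two points independently writes the difference of two averages as one
  double average of differences. This yields both a bound that loses nothing and, when one pair of
  indices is known to have a small difference, a strict gain proportional to its weight.\<close>

lemma avg_op_diff:
  assumes x: "x \<in> S" and y: "y \<in> S"
  shows "avg_op u x - avg_op u y = (\<Sum>i<n. \<Sum>j<n. p i x * p j y * (u (T i x) - u (T j y)))"
proof -
  have "(\<Sum>i<n. \<Sum>j<n. p i x * p j y * (u (T i x) - u (T j y)))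
      = (\<Sum>i<n. p i x * u (T i x) * (\<Sum>j<n. p j y)) - (\<Sum>i<n. p i x * (\<Sum>j<n. p j y * u (T j y)))"
    by (simp add: algebra_simps sum_subtractf sum_distrib_left sum_distrib_right)
  also have "\<dots> = avg_op u x - (\<Sum>i<n. p i x) * avg_op u y"
    by (simp add: weight_sum y avg_op_def sum_distrib_right)
  finally show ?thesis by (simp add: weight_sum x)
qed

lemma avg_op_oscillation_gain:
  assumes n: "0 < n" and x: "x \<in> S" and y: "y \<in> S"
    and o: "\<And>x y. x \<in> S \<Longrightarrow> y \<in> S \<Longrightarrow> \<bar>u x - u y\<bar> \<le> b"
    and e: "\<bar>u (T 0 x) - u (T 0 y)\<bar> \<le> e" and "e \<le> b"
    and w: "0 \<le> w" "w \<le> p 0 x" "w \<le> p 0 y"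
  shows "\<bar>avg_op u x - avg_op u y\<bar> \<le> b - w\<^sup>2 * (b - e)"
proof -
  have W: "(\<Sum>i<n. \<Sum>j<n. p i x * p j y) = 1"
    by (simp add: weight_sum x y flip: sum_distrib_left)
  have "\<bar>avg_op u x - avg_op u y\<bar>
      \<le> (\<Sum>i<n. \<Sum>j<n. p i x * p j y * (b - (if i = 0 then if j = 0 then b - e else 0 else 0)))"
    unfolding avg_op_diff[OF x y]
    using e o maps_into x y weight_nonneg
    by (intro sum_abs[THEN order_trans] sum_mono)
       (auto simp: abs_mult intro!: mult_left_mono)
  also have "\<dots> = (\<Sum>i<n. \<Sum>j<n. p i x * p j y) * b - p 0 x * p 0 y * (b - e)"
  proof -
    have 1: "p i x * p j y * (b - (if i = 0 then if j = 0 then b - e else 0 else 0))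
       = p i x * p j y * b - (if i = 0 then if j = 0 then p 0 x * p 0 y * (b - e) else 0 else 0)" for i j
      by (auto simp: algebra_simps)
    have "(\<Sum>i<n. \<Sum>j<n. (if i = 0 then if j = 0 then p 0 x * p 0 y * (b - e) else 0 else 0))
       = (\<Sum>i<n. if i = 0 then (\<Sum>j<n. if j = 0 then p 0 x * p 0 y * (b - e) else 0) else 0)"
      by (intro sum.cong) auto
    also have "\<dots> = p 0 x * p 0 y * (b - e)"
      using n by (simp add: sum.delta)
    finally show ?thesis
      unfolding 1 by (simp add: sum_subtractf sum_distrib_right)
  qed
  also have "\<dots> \<le> b - w\<^sup>2 * (b - e)"
  proof -
    have "w * w \<le> p 0 x * p 0 y"
      using w weight_nonneg n x y by (intro mult_mono) auto
    then show ?thesis using W \<open>e \<le> b\<close>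
      by (simp add: power2_eq_square mult_right_mono)
  qed
  finally show ?thesis .
qed

lemma avg_op_oscillation_mono:
  assumes n: "0 < n" and x: "x \<in> S" and y: "y \<in> S"
    and o: "\<And>x y. x \<in> S \<Longrightarrow> y \<in> S \<Longrightarrow> \<bar>u x - u y\<bar> \<le> b"
  shows "\<bar>avg_op u x - avg_op u y\<bar> \<le> b"
proof -
  have "\<bar>u (T 0 x) - u (T 0 y)\<bar> \<le> b" by (intro o maps_into n x y)
  from avg_op_oscillation_gain[OF n x y o this, where w = 0] show ?thesis
    using weight_nonneg[OF n x] weight_nonneg[OF n y] by simp
qed

end

locale contracting_random_maps = random_maps +
  fixes \<rho> :: "'a \<Rightarrow> 'a \<Rightarrow> real" and q c \<delta> D :: real
  assumes n_pos: "0 < n"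
    and dist_nonneg: "\<lbrakk>x \<in> S; y \<in> S\<rbrakk> \<Longrightarrow> 0 \<le> \<rho> x y"
    and dist_le: "\<lbrakk>x \<in> S; y \<in> S\<rbrakk> \<Longrightarrow> \<rho> x y \<le> D"
    and q: "0 \<le> q" "q < 1"
    and contraction: "\<lbrakk>j < n; x \<in> S; y \<in> S\<rbrakk> \<Longrightarrow> \<rho> (T j x) (T j y) \<le> q * \<rho> x y"
    and c_nonneg: "0 \<le> c"
    and weight_lipschitz: "\<lbrakk>j < n; x \<in> S; y \<in> S\<rbrakk> \<Longrightarrow> \<bar>p j x - p j y\<bar> \<le> c * \<rho> x y"
    and \<delta>: "0 < \<delta>" and weight_lower: "y \<in> S \<Longrightarrow> \<delta> \<le> p 0 y"
begin

text \<open>One application multiplies the old Lipschitz constant by \<open>q\<close> and adds the contribution of the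
  weights. The constants of the iterates therefore follow the affine recursion
  \<open>L \<mapsto> q L + n c G\<close>, which stays bounded because \<open>q < 1\<close>.\<close>

lemma avg_op_lipschitz:
  assumes G: "\<And>y. y \<in> S \<Longrightarrow> \<bar>g y\<bar> \<le> G"
    and L: "0 \<le> L" "\<And>x y. x \<in> S \<Longrightarrow> y \<in> S \<Longrightarrow> \<bar>g x - g y\<bar> \<le> L * \<rho> x y"
    and x: "x \<in> S" and y: "y \<in> S"
  shows "\<bar>avg_op g x - avg_op g y\<bar> \<le> (q * L + n * c * G) * \<rho> x y"
proof -
  have G0: "0 \<le> G" using G[OF x] by linarith
  have "avg_op g x - avg_op g y
      = (\<Sum>j<n. p j x * (g (T j x) - g (T j y)) + (p j x - p j y) * g (T j y))"
    by (simp add: avg_op_def algebra_simps flip: sum_subtractf)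
  also have "\<bar>\<dots>\<bar> \<le> (\<Sum>j<n. p j x * (q * L * \<rho> x y) + c * \<rho> x y * G)"
  proof (intro sum_abs[THEN order_trans] sum_mono)
    fix j assume "j \<in> {..<n}"
    then have j: "j < n" by simp
    have "\<bar>g (T j x) - g (T j y)\<bar> \<le> L * \<rho> (T j x) (T j y)"
      using L maps_into j x y by auto
    also have "\<dots> \<le> L * (q * \<rho> x y)"
      using contraction[OF j x y] L by (intro mult_left_mono) auto
    finally have 1: "\<bar>g (T j x) - g (T j y)\<bar> \<le> q * L * \<rho> x y" by (simp add: mult_ac)
    have 2: "\<bar>p j x - p j y\<bar> * \<bar>g (T j y)\<bar> \<le> (c * \<rho> x y) * G"
      using weight_lipschitz[OF j x y] G[OF maps_into[OF j y]] c_nonneg dist_nonneg[OF x y]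
      by (intro mult_mono) auto
    have "p j x * \<bar>g (T j x) - g (T j y)\<bar> \<le> p j x * (q * L * \<rho> x y)"
      using 1 weight_nonneg[OF j x] by (intro mult_left_mono)
    with 2 show "\<bar>p j x * (g (T j x) - g (T j y)) + (p j x - p j y) * g (T j y)\<bar>
        \<le> p j x * (q * L * \<rho> x y) + c * \<rho> x y * G"
      using weight_nonneg[OF j x] by (intro abs_triangle_ineq[THEN order_trans]) (auto simp: abs_mult)
  qed
  also have "\<dots> = (\<Sum>j<n. p j x) * (q * L * \<rho> x y) + n * (c * \<rho> x y * G)"
    by (simp add: sum.distrib sum_distrib_right)
  also have "\<dots> = (q * L + n * c * G) * \<rho> x y"
    by (simp add: weight_sum x algebra_simps)
  finally show ?thesis .
qed

lemma avg_op_iterates_equilipschitz: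
  assumes G: "\<And>y. y \<in> S \<Longrightarrow> \<bar>g y\<bar> \<le> G" and "0 \<le> G"
    and L: "0 \<le> L" "\<And>x y. x \<in> S \<Longrightarrow> y \<in> S \<Longrightarrow> \<bar>g x - g y\<bar> \<le> L * \<rho> x y"
    and x: "x \<in> S" and y: "y \<in> S"
  shows "\<bar>(avg_op ^^ N) g x - (avg_op ^^ N) g y\<bar> \<le> (L + n * c * G / (1 - q)) * \<rho> x y"
  using x y
proof (induction N arbitrary: x y)
  case 0
  have "0 \<le> n * c * G / (1 - q)" using c_nonneg q \<open>0 \<le> G\<close> by simp
  then have "L * \<rho> x y \<le> (L + n * c * G / (1 - q)) * \<rho> x y"
    using dist_nonneg[OF 0] by (intro mult_right_mono) auto
  with L(2)[OF 0] show ?case by simp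
next
  case (Suc N)
  let ?C = "L + n * c * G / (1 - q)"
  have C0: "0 \<le> ?C" using c_nonneg q L(1) \<open>0 \<le> G\<close> by simp
  have "\<bar>avg_op ((avg_op ^^ N) g) x - avg_op ((avg_op ^^ N) g) y\<bar> \<le> (q * ?C + n * c * G) * \<rho> x y"
    by (rule avg_op_lipschitz[OF avg_op_iterate_bounded[OF G] C0 Suc.IH Suc.prems])
  also have "\<dots> \<le> ?C * \<rho> x y"
  proof (rule mult_right_mono)
    define E where "E = n * c * G / (1 - q)"
    have "n * c * G = (1 - q) * E"
      using q by (simp add: E_def)
    moreover have "0 \<le> (1 - q) * L" using q L(1) by simp
    ultimately show "q * ?C + n * c * G \<le> ?C"
      unfolding E_def[symmetric] by (simp add: algebra_simps)
  qed (rule dist_nonneg[OF Suc.prems])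
  finally show ?case by simp
qed

text \<open>The word consisting of \<open>r\<close> zeros has probability at least \<open>\<delta> ^ r\<close> from every starting point
  and shrinks the space by \<open>q ^ r\<close>. Two chains that follow it at the same time lose almost all of the
  oscillation of a Lipschitz function; the other pairs of words do not increase it.\<close>

lemma avg_op_iterate_oscillation:
  assumes b: "\<And>x y. x \<in> S \<Longrightarrow> y \<in> S \<Longrightarrow> \<bar>u x - u y\<bar> \<le> b"
    and L: "0 \<le> L" "\<And>x y. x \<in> S \<Longrightarrow> y \<in> S \<Longrightarrow> \<bar>u x - u y\<bar> \<le> L * \<rho> x y"
    and x: "x \<in> S" and y: "y \<in> S"
  shows "\<bar>(avg_op ^^ r) u x - (avg_op ^^ r) u y\<bar> \<le> b"
    and "\<bar>(avg_op ^^ r) u x - (avg_op ^^ r) u y\<bar> \<le> b - \<delta> ^ (2 * r) * (b - L * q ^ r * \<rho> x y)"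
  using x y
proof (induction r arbitrary: x y)
  case 0
  { case 1 then show ?case using b by simp }
  { case 2 then show ?case using L by simp }
next
  case (Suc r)
  let ?u = "(avg_op ^^ r) u"
  { case 1 then show ?case
      using avg_op_oscillation_mono[OF n_pos _ _ Suc.IH(1)] by simp }
  { case 2
    note xy = maps_into[OF n_pos 2(1)] maps_into[OF n_pos 2(2)]
    let ?e = "b - \<delta> ^ (2 * r) * (b - L * q ^ Suc r * \<rho> x y)"
    show ?case
    proof (cases "L * q ^ Suc r * \<rho> x y \<le> b")
      case True
      have "\<bar>?u (T 0 x) - ?u (T 0 y)\<bar> \<le> b - \<delta> ^ (2 * r) * (b - L * q ^ r * \<rho> (T 0 x) (T 0 y))"
        by (rule Suc.IH(2)[OF xy])
      also have "\<dots> \<le> ?e"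
      proof -
        have "L * q ^ r * \<rho> (T 0 x) (T 0 y) \<le> L * q ^ r * (q * \<rho> x y)"
          using contraction[OF n_pos 2] L q by (intro mult_left_mono) auto
        then show ?thesis using \<delta> by (simp add: mult_ac)
      qed
      finally have e: "\<bar>?u (T 0 x) - ?u (T 0 y)\<bar> \<le> ?e" .
      have "?e \<le> b" using True \<delta> by simp
      from avg_op_oscillation_gain[OF n_pos 2 Suc.IH(1) e this _ weight_lower[OF 2(1)] weight_lower[OF 2(2)]] \<delta>
      show ?thesis by (simp add: power2_eq_square mult_ac)
    next
      case False
      then have "b \<le> b - \<delta> ^ (2 * Suc r) * (b - L * q ^ Suc r * \<rho> x y)"
        using \<delta> by (simp add: mult_nonneg_nonpos)
      moreover have "\<bar>(avg_op ^^ Suc r) u x - (avg_op ^^ Suc r) u y\<bar> \<le> b"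
        using 2 avg_op_oscillation_mono[OF n_pos _ _ Suc.IH(1)] by simp
      ultimately show ?thesis by linarith
    qed }
qed

text \<open>Let \<open>\<ell>\<close> be the infimum of the oscillations of the iterates. Applying \<open>r\<close> more steps to an
  iterate of oscillation close to \<open>\<ell>\<close> gives \<open>\<ell> \<le> L q ^ r D\<close>, where \<open>L\<close> is a common Lipschitz
  constant; as \<open>r\<close> is arbitrary, \<open>\<ell> = 0\<close>.\<close>

theorem avg_op_iterates_flatten:
  assumes G: "\<And>y. y \<in> S \<Longrightarrow> \<bar>g y\<bar> \<le> G" and "0 \<le> G"
    and L: "0 \<le> L" "\<And>x y. x \<in> S \<Longrightarrow> y \<in> S \<Longrightarrow> \<bar>g x - g y\<bar> \<le> L * \<rho> x y"
    and \<epsilon>: "0 < \<epsilon>"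
  obtains N where "\<And>x y. x \<in> S \<Longrightarrow> y \<in> S \<Longrightarrow> \<bar>(avg_op ^^ N) g x - (avg_op ^^ N) g y\<bar> \<le> \<epsilon>"
proof -
  define C where "C = L + n * c * G / (1 - q)"
  have C0: "0 \<le> C" unfolding C_def using c_nonneg q L(1) \<open>0 \<le> G\<close> by simp
  have C: "\<bar>(avg_op ^^ N) g x - (avg_op ^^ N) g y\<bar> \<le> C * \<rho> x y" if "x \<in> S" "y \<in> S" for x y N
    unfolding C_def by (rule avg_op_iterates_equilipschitz[OF G \<open>0 \<le> G\<close> L that])
  define Bs where "Bs = {b. 0 \<le> b \<and> (\<exists>N. \<forall>x\<in>S. \<forall>y\<in>S. \<bar>(avg_op ^^ N) g x - (avg_op ^^ N) g y\<bar> \<le> b)}"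
  have bdd: "bdd_below Bs" unfolding Bs_def by (auto intro: bdd_belowI[of _ 0])
  have "C * \<bar>D\<bar> \<in> Bs"
  proof -
    have "\<bar>(avg_op ^^ 0) g x - (avg_op ^^ 0) g y\<bar> \<le> C * \<bar>D\<bar>" if xy: "x \<in> S" "y \<in> S" for x y
      using dist_le[OF xy] C0 by (intro order_trans[OF C[OF xy, of 0]] mult_left_mono) auto
    then show ?thesis unfolding Bs_def using C0 by (auto intro!: exI[of _ 0] simp del: funpow.simps)
  qed
  then have ne: "Bs \<noteq> {}" by auto
  define l where "l = Inf Bs"
  have l0: "0 \<le> l" unfolding l_def using ne by (intro cInf_greatest) (auto simp: Bs_def)
  have step: "l \<le> C * q ^ r * \<bar>D\<bar>" for r
  proof (rule ccontr)
    assume "\<not> ?thesis"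
    then have less: "C * q ^ r * \<bar>D\<bar> < l" by simp
    have "l \<le> b - \<delta> ^ (2 * r) * (l - C * q ^ r * \<bar>D\<bar>)" if b: "b \<in> Bs" for b
    proof -
      from b obtain N where N: "0 \<le> b"
        "\<And>x y. x \<in> S \<Longrightarrow> y \<in> S \<Longrightarrow> \<bar>(avg_op ^^ N) g x - (avg_op ^^ N) g y\<bar> \<le> b"
        unfolding Bs_def by blast
      have lb: "l \<le> b" unfolding l_def by (rule cInf_lower[OF b bdd])
      let ?b = "b - \<delta> ^ (2 * r) * (l - C * q ^ r * \<bar>D\<bar>)"
      have *: "\<bar>(avg_op ^^ (r + N)) g x - (avg_op ^^ (r + N)) g y\<bar> \<le> ?b" if xy: "x \<in> S" "y \<in> S" for x y
      proof -
        have "\<bar>(avg_op ^^ (r + N)) g x - (avg_op ^^ (r + N)) g y\<bar>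
            \<le> b - \<delta> ^ (2 * r) * (b - C * q ^ r * \<rho> x y)"
          using avg_op_iterate_oscillation(2)[OF N(2) C0 C xy, of r] by (simp add: funpow_add)
        also have "\<dots> \<le> ?b"
        proof -
          have "C * q ^ r * \<rho> x y \<le> C * q ^ r * \<bar>D\<bar>"
            using dist_le[OF xy] C0 q by (intro mult_left_mono) auto
          then have "l - C * q ^ r * \<bar>D\<bar> \<le> b - C * q ^ r * \<rho> x y" using lb by linarith
          then show ?thesis using \<delta> by simp
        qed
        finally show ?thesis .
      qed
      show ?thesis
      proof (cases "S = {}")
        case True
        then have "0 \<in> Bs" unfolding Bs_def by auto
        then have "l \<le> 0" unfolding l_def by (rule cInf_lower[OF _ bdd])
        with less C0 q show ?thesis by (smt (verit) abs_ge_zero mult_nonneg_nonneg zero_le_power)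
      next
        case False
        then obtain x where "x \<in> S" by auto
        from *[OF this this] have "0 \<le> ?b" by simp
        with * have "?b \<in> Bs" unfolding Bs_def by blast
        then show ?thesis unfolding l_def by (rule cInf_lower[OF _ bdd])
      qed
    qed
    then have "l + \<delta> ^ (2 * r) * (l - C * q ^ r * \<bar>D\<bar>) \<le> Inf Bs"
      using ne by (intro cInf_greatest) (auto simp: algebra_simps)
    moreover have "0 < \<delta> ^ (2 * r) * (l - C * q ^ r * \<bar>D\<bar>)" using less \<delta> by simp
    ultimately show False unfolding l_def by linarith
  qed
  have "(\<lambda>r. C * q ^ r * \<bar>D\<bar>) \<longlonglongrightarrow> C * 0 * \<bar>D\<bar>"
    using q by (intro tendsto_intros LIMSEQ_realpow_zero) auto
  then have "l \<le> C * 0 * \<bar>D\<bar>" by (rule LIMSEQ_le_const) (use step in auto)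
  then have "Inf Bs < \<epsilon>" using \<epsilon> l_def by simp
  then obtain b where "b \<in> Bs" "b < \<epsilon>" using cInf_lessD[OF ne] by blast
  then obtain N where "\<And>x y. x \<in> S \<Longrightarrow> y \<in> S \<Longrightarrow> \<bar>(avg_op ^^ N) g x - (avg_op ^^ N) g y\<bar> \<le> b"
    unfolding Bs_def by blast
  with \<open>b < \<epsilon>\<close> show thesis by (intro that[of N]) (meson less_imp_le order_trans)
qed

end

section \<open>Borel measures on compact metrizable spaces\<close>

lemma sets_borel_of: "sets (borel_of X) = sigma_sets (topspace X) {U. openin X U}"
  unfolding borel_of_def by (intro sets_measure_of subsetI) (simp add: openin_subset)

lemma space_borel_of: "space (borel_of X) = topspace X"
  unfolding borel_of_def by (intro space_measure_of subsetI) (simp add: openin_subset)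

lemma openin_in_borel_of: "openin X U \<Longrightarrow> U \<in> sets (borel_of X)"
  unfolding sets_borel_of by (intro sigma_sets.Basic CollectI)

lemma closedin_in_borel_of:
  assumes "closedin X C" shows "C \<in> sets (borel_of X)"
proof -
  have "openin X (topspace X - C)" using assms by (simp add: closedin_def)
  then have "space (borel_of X) - (topspace X - C) \<in> sets (borel_of X)"
    by (intro sets.compl_sets openin_in_borel_of)
  moreover have "space (borel_of X) - (topspace X - C) = C"
    using closedin_subset[OF assms] by (simp add: space_borel_of double_diff)
  ultimately show ?thesis by simp
qed

lemma continuous_map_borel_measurable:
  assumes "continuous_map X euclidean f"
  shows "f \<in> borel_measurable (borel_of X)"
proof (rule borel_measurableI)
  fix S :: "'b set" assume "open S"
  then have "openin X {x \<in> topspace X. f x \<in> S}"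
    using openin_continuous_map_preimage[OF assms] by simp
  moreover have "f -` S \<inter> space (borel_of X) = {x \<in> topspace X. f x \<in> S}"
    by (auto simp: space_borel_of)
  ultimately show "f -` S \<inter> space (borel_of X) \<in> sets (borel_of X)"
    by (simp add: openin_in_borel_of)
qed

lemma continuous_map_measurable_borel_of:
  assumes f: "continuous_map X Y f"
  shows "f \<in> borel_of X \<rightarrow>\<^sub>M borel_of Y"
proof (rule measurable_sigma_sets[OF sets_borel_of])
  show "{U. openin Y U} \<subseteq> Pow (topspace Y)" by (auto dest: openin_subset[THEN subsetD])
  show "f \<in> space (borel_of X) \<rightarrow> topspace Y"
    using continuous_map_image_subset_topspace[OF f] by (auto simp: space_borel_of)
  fix U assume "U \<in> {U. openin Y U}"
  then have "openin X {x \<in> topspace X. f x \<in> U}"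
    using openin_continuous_map_preimage[OF f] by simp
  moreover have "f -` U \<inter> space (borel_of X) = {x \<in> topspace X. f x \<in> U}"
    by (auto simp: space_borel_of)
  ultimately show "f -` U \<inter> space (borel_of X) \<in> sets (borel_of X)"
    by (simp add: openin_in_borel_of)
qed

text \<open>The sets that can be squeezed between a closed and an open set up to arbitrarily small measure
  form a sigma algebra; in a metrizable space it contains the open sets, since these are countable
  unions of closed sets.\<close>

lemma closed_open_approximation:
  assumes X: "metrizable_space X" and M: "finite_measure M" "sets M = sets (borel_of X)"
    and A: "A \<in> sets M" and e: "0 < (e::real)"
  obtains C U where "closedin X C" "openin X U" "C \<subseteq> A" "A \<subseteq> U" "measure M (U - C) < e"
proof -
  interpret finite_measure M by fact
  have op: "openin X U \<Longrightarrow> U \<in> sets M" for U using M(2) openin_in_borel_of by blast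
  have cl: "closedin X C \<Longrightarrow> C \<in> sets M" for C using M(2) closedin_in_borel_of by blast
  define P where "P A \<longleftrightarrow> (\<forall>e>0. \<exists>C U. closedin X C \<and> openin X U \<and> C \<subseteq> A \<and> A \<subseteq> U \<and> measure M (U - C) < e)"
    for A
  from A have "A \<in> sigma_sets (topspace X) {U. openin X U}"
    by (simp add: M(2) sets_borel_of)
  then have "P A"
  proof induction
    case (Basic A)
    then have oA: "openin X A" by simp
    then obtain C where C: "\<And>n::nat. closedin X (C n)" "\<And>n. C n \<subseteq> C (Suc n)" "\<Union>(range C) = A"
      using open_imp_fsigma_in[OF X oA] unfolding fsigma_in_ascending by blast
    have "(\<lambda>n. measure M (C n)) \<longlonglongrightarrow> measure M (\<Union>n. C n)"
      using C by (intro finite_Lim_measure_incseq) (auto intro: cl incseq_SucI)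
    then have lim: "(\<lambda>n. measure M (C n)) \<longlonglongrightarrow> measure M A" using C(3) by simp
    show ?case
      unfolding P_def
    proof (intro allI impI)
      fix e :: real assume "0 < e"
      from LIMSEQ_D[OF lim this] obtain n where "\<bar>measure M (C n) - measure M A\<bar> < e" by auto
      moreover have sub: "C n \<subseteq> A" using C(3) by blast
      then have "measure M (A - C n) = measure M A - measure M (C n)"
        by (intro finite_measure_Diff op[OF oA] cl C(1))
      ultimately have "measure M (A - C n) < e" by linarith
      with oA C(1) sub show "\<exists>C U. closedin X C \<and> openin X U \<and> C \<subseteq> A \<and> A \<subseteq> U \<and> measure M (U - C) < e"
        by blast
    qed
  next
    case Empty
    show ?case unfolding P_def
      by (intro allI impI exI[of _ "{}"]) simp
  next
    case (Compl A)
    show ?case unfolding P_def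
    proof (intro allI impI)
      fix e :: real assume "0 < e"
      from Compl.IH[unfolded P_def, rule_format, OF this]
      obtain C U where CU: "closedin X C" "openin X U" "C \<subseteq> A" "A \<subseteq> U" "measure M (U - C) < e"
        by (elim exE conjE)
      have "(topspace X - C) - (topspace X - U) = U - C"
        using openin_subset[OF CU(2)] by blast
      with CU show "\<exists>C U. closedin X C \<and> openin X U \<and> C \<subseteq> topspace X - A \<and> topspace X - A \<subseteq> U \<and> measure M (U - C) < e"
        by (intro exI[of _ "topspace X - U"] exI[of _ "topspace X - C"]) (auto simp: closedin_def)
    qed
  next
    case (Union A)
    show ?case unfolding P_def
    proof (intro allI impI)
      fix e :: real assume e: "0 < e"
      have "\<exists>C U. closedin X C \<and> openin X U \<and> C \<subseteq> A i \<and> A i \<subseteq> U \<and> measure M (U - C) < e / 2 * (1/2) ^ Suc i" for i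
        by (rule Union.IH[of i, unfolded P_def, rule_format]) (use e in simp)
      then obtain C U where CU: "\<And>i. closedin X (C i)" "\<And>i. openin X (U i)" "\<And>i. C i \<subseteq> A i"
        "\<And>i. A i \<subseteq> U i" "\<And>i. measure M (U i - C i) < e / 2 * (1/2) ^ Suc i"
        by metis
      let ?D = "\<lambda>k. \<Union>i\<le>k. C i"
      have clD: "closedin X (?D k)" for k using CU(1) by (intro closedin_Union) auto
      have opU: "openin X (\<Union>i. U i)" using CU(2) by (intro openin_Union) auto
      have setsUC: "U i - C i \<in> sets M" for i by (intro sets.Diff op cl CU)
      have setC: "(\<Union>i. C i) \<in> sets M" using cl[OF CU(1)] by auto
      have sums: "(\<lambda>i. e / 2 * (1/2) ^ Suc i) sums (e / 2 * 1)"
        by (intro sums_mult power_half_series)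
      have summ: "summable (\<lambda>i. measure M (U i - C i))"
        using CU(5) by (intro summable_comparison_test'[OF sums_summable[OF sums], of 0]) (simp add: less_imp_le)
      have "measure M ((\<Union>i. U i) - (\<Union>i. C i)) \<le> measure M (\<Union>i. U i - C i)"
        using setsUC by (intro finite_measure_mono) auto
      also have "\<dots> \<le> (\<Sum>i. measure M (U i - C i))"
        using setsUC summ by (intro finite_measure_subadditive_countably) auto
      also have "\<dots> \<le> (\<Sum>i. e / 2 * (1/2) ^ Suc i)"
        using CU(5) by (intro suminf_le summ sums_summable[OF sums] less_imp_le)
      also have "\<dots> = e / 2" using sums_unique[OF sums] by simp
      finally have 1: "measure M ((\<Union>i. U i) - (\<Union>i. C i)) \<le> e / 2" .
      have "(\<lambda>k. measure M (?D k)) \<longlonglongrightarrow> measure M (\<Union>k. ?D k)"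
      proof (intro finite_Lim_measure_incseq)
        show "range ?D \<subseteq> sets M" using cl[OF clD] by auto
        show "incseq ?D" by (intro incseq_SucI UN_mono) auto
      qed
      moreover have "(\<Union>k. ?D k) = (\<Union>i. C i)" by blast
      ultimately have "(\<lambda>k. measure M (?D k)) \<longlonglongrightarrow> measure M (\<Union>i. C i)" by simp
      from LIMSEQ_D[OF this, of "e / 2"] e obtain k where k: "\<bar>measure M (?D k) - measure M (\<Union>i. C i)\<bar> < e / 2"
        by auto
      have "measure M ((\<Union>i. C i) - ?D k) = measure M (\<Union>i. C i) - measure M (?D k)"
        using cl[OF clD] setC by (intro finite_measure_Diff) auto
      with k have 2: "measure M ((\<Union>i. C i) - ?D k) < e / 2" by linarith
      have "measure M ((\<Union>i. U i) - ?D k)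
          \<le> measure M (((\<Union>i. U i) - (\<Union>i. C i)) \<union> ((\<Union>i. C i) - ?D k))"
        using op[OF opU] setC cl[OF clD] by (intro finite_measure_mono) auto
      also have "\<dots> \<le> measure M ((\<Union>i. U i) - (\<Union>i. C i)) + measure M ((\<Union>i. C i) - ?D k)"
        using op[OF opU] setC cl[OF clD] by (intro measure_Un_le) auto
      finally have "measure M ((\<Union>i. U i) - ?D k) < e" using 1 2 by linarith
      moreover have "?D k \<subseteq> (\<Union>i. A i)" "(\<Union>i. A i) \<subseteq> (\<Union>i. U i)"
        by (intro UN_mono CU(3,4); simp)+
      ultimately show "\<exists>C U. closedin X C \<and> openin X U \<and> C \<subseteq> \<Union> (range A) \<and> \<Union> (range A) \<subseteq> U \<and> measure M (U - C) < e"
        using clD opU by (intro exI conjI)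
    qed
  qed
  from this[unfolded P_def, rule_format, OF e] obtain C U where
    "closedin X C" "openin X U" "C \<subseteq> A" "A \<subseteq> U" "measure M (U - C) < e"
    by (elim exE conjE)
  then show thesis by (rule that)
qed

theorem finite_borel_measure_regular:
  assumes X: "metrizable_space X" "compact_space X"
    and M: "finite_measure M" "sets M = sets (borel_of X)"
  shows "regular_measure X M"
  unfolding regular_measure_def
proof (intro ballI conjI)
  interpret finite_measure M by fact
  fix A assume A: "A \<in> sets M"
  have approx: "\<exists>C U. closedin X C \<and> openin X U \<and> C \<subseteq> A \<and> A \<subseteq> U \<and> C \<in> sets M \<and> U \<in> sets M \<and>
      emeasure M A \<le> emeasure M C + ennreal e \<and> emeasure M U \<le> emeasure M A + ennreal e" if e: "0 < e" for e
  proof -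
    obtain C U where CU: "closedin X C" "openin X U" "C \<subseteq> A" "A \<subseteq> U" "measure M (U - C) < e"
      using closed_open_approximation[OF X(1) M A e] .
    have s: "C \<in> sets M" "U \<in> sets M"
      using CU M(2) openin_in_borel_of closedin_in_borel_of by blast+
    have "measure M A - measure M C = measure M (A - C)" "measure M U - measure M A = measure M (U - A)"
      using s CU A by (simp_all add: finite_measure_Diff)
    moreover have "measure M (A - C) \<le> measure M (U - C)" "measure M (U - A) \<le> measure M (U - C)"
      using s CU A by (auto intro!: finite_measure_mono)
    ultimately have "measure M A \<le> measure M C + e" "measure M U \<le> measure M A + e"
      using CU(5) by linarith+
    then have "emeasure M A \<le> emeasure M C + ennreal e" "emeasure M U \<le> emeasure M A + ennreal e"
      using e by (simp_all add: emeasure_eq_measure ennreal_leI flip: ennreal_plus)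
    with CU s show ?thesis by blast
  qed
  show "emeasure M A = (SUP K\<in>{K\<in>sets M. compactin X K \<and> K \<subseteq> A}. emeasure M K)"
  proof (rule antisym)
    show "emeasure M A \<le> (SUP K\<in>{K\<in>sets M. compactin X K \<and> K \<subseteq> A}. emeasure M K)"
    proof (rule ennreal_le_epsilon)
      fix e :: real assume "0 < e"
      from approx[OF this] obtain C where C: "closedin X C" "C \<subseteq> A" "C \<in> sets M"
        "emeasure M A \<le> emeasure M C + ennreal e" by blast
      have "emeasure M C \<le> (SUP K\<in>{K\<in>sets M. compactin X K \<and> K \<subseteq> A}. emeasure M K)"
        using C closedin_compact_space[OF X(2)] by (intro SUP_upper) simp
      with C(4) show "emeasure M A \<le> (SUP K\<in>{K\<in>sets M. compactin X K \<and> K \<subseteq> A}. emeasure M K) + ennreal e"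
        by (meson add_right_mono order_trans)
    qed
  qed (use A in \<open>auto intro!: SUP_least emeasure_mono\<close>)
  show "emeasure M A = (INF U\<in>{U. openin X U \<and> A \<subseteq> U}. emeasure M U)"
  proof (rule antisym)
    show "(INF U\<in>{U. openin X U \<and> A \<subseteq> U}. emeasure M U) \<le> emeasure M A"
    proof (rule ennreal_le_epsilon)
      fix e :: real assume "0 < e"
      from approx[OF this] obtain U where U: "openin X U" "A \<subseteq> U"
        "emeasure M U \<le> emeasure M A + ennreal e" by blast
      have "(INF U\<in>{U. openin X U \<and> A \<subseteq> U}. emeasure M U) \<le> emeasure M U"
        using U by (intro INF_lower) simp
      with U(3) show "(INF U\<in>{U. openin X U \<and> A \<subseteq> U}. emeasure M U) \<le> emeasure M A + ennreal e"
        by (rule order_trans[rotated])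
    qed
    have "emeasure M A \<le> emeasure M U" if "openin X U" "A \<subseteq> U" for U
      using that openin_in_borel_of M(2) by (intro emeasure_mono) auto
    then show "emeasure M A \<le> (INF U\<in>{U. openin X U \<and> A \<subseteq> U}. emeasure M U)"
      by (intro INF_greatest) auto
  qed
qed

text \<open>A closed set and an open neighbourhood of almost the same measure are separated by a continuous
  function, whose integral is then almost the measure of the closed set; and the closed sets generate
  the Borel sets.\<close>

theorem Prob_eqI_continuous:
  assumes X: "metrizable_space X"
    and P: "P \<in> Prob X" and Q: "Q \<in> Prob X"
    and eq: "\<And>g :: 'b \<Rightarrow> real. continuous_map X euclideanreal g \<Longrightarrow> (\<integral>x. g x \<partial>P) = (\<integral>x. g x \<partial>Q)"
  shows "P = Q"
proof -
  have le: "emeasure P C \<le> emeasure Q C"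
    if P: "P \<in> Prob X" and Q: "Q \<in> Prob X" and C: "closedin X C"
      and eq: "\<And>g :: 'b \<Rightarrow> real. continuous_map X euclideanreal g \<Longrightarrow> (\<integral>x. g x \<partial>P) = (\<integral>x. g x \<partial>Q)"
    for P Q :: "'b measure" and C
  proof -
    interpret P: prob_space P using P by (simp add: Prob_def)
    interpret Q: prob_space Q using Q by (simp add: Prob_def)
    have setsP: "sets P = sets (borel_of X)" and setsQ: "sets Q = sets (borel_of X)"
      using P Q by (simp_all add: Prob_def)
    have spP: "space P = topspace X" and spQ: "space Q = topspace X"
      using sets_eq_imp_space_eq[OF setsP] sets_eq_imp_space_eq[OF setsQ] by (simp_all add: space_borel_of)
    have Cs: "C \<in> sets P" "C \<in> sets Q" using C by (simp_all add: setsP setsQ closedin_in_borel_of)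
    have "emeasure Q C = (INF U\<in>{U. openin X U \<and> C \<subseteq> U}. emeasure Q U)"
    proof -
      have "regular_measure X Q" using Q by (simp add: Prob_def)
      from bspec[OF this[unfolded regular_measure_def] Cs(2)] show ?thesis by (rule conjunct2)
    qed
    moreover have "emeasure P C \<le> emeasure Q U" if U: "openin X U" "C \<subseteq> U" for U
    proof -
      have Us: "U \<in> sets Q" using U by (simp add: setsQ openin_in_borel_of)
      have "closedin X (topspace X - U)" using U(1) by blast
      moreover have "disjnt (topspace X - U) C" using U(2) by (auto simp: disjnt_def)
      ultimately obtain f :: "'b \<Rightarrow> real" where f: "continuous_map X (top_of_set {0..1}) f"
        "f ` (topspace X - U) \<subseteq> {0}" "f ` C \<subseteq> {1}"
        using Urysohn_lemma[OF metrizable_imp_normal_space[OF X] _ C, of "topspace X - U" 0 1] by auto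
      have fc: "continuous_map X euclideanreal f"
        using f(1) by (rule continuous_map_into_fulltopology)
      have f01: "0 \<le> f x" "f x \<le> 1" if "x \<in> topspace X" for x
        using continuous_map_image_subset_topspace[OF f(1)] that by auto
      have meas: "f \<in> borel_measurable P" "f \<in> borel_measurable Q"
        using continuous_map_borel_measurable[OF fc] by (simp_all add: measurable_cong_sets[OF setsP refl] measurable_cong_sets[OF setsQ refl])
      have intP: "integrable P f" and intQ: "integrable Q f"
        using f01 meas by (auto intro!: P.integrable_const_bound[where B = 1] Q.integrable_const_bound[where B = 1] AE_I2 simp: spP spQ)
      have "measure P C = (\<integral>x. indicator C x \<partial>P)" using Cs by simp
      also have "\<dots> \<le> (\<integral>x. f x \<partial>P)"
        using Cs f f01 intP
        by (intro integral_mono integrable_real_indicator) (auto simp: P.emeasure_eq_measure spP indicator_def)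
      also have "\<dots> = (\<integral>x. f x \<partial>Q)" by (rule eq[OF fc])
      also have "\<dots> \<le> (\<integral>x. indicator U x \<partial>Q)"
        using Us f f01 intQ
        by (intro integral_mono integrable_real_indicator) (auto simp: Q.emeasure_eq_measure spQ indicator_def)
      also have "\<dots> = measure Q U" using Us by simp
      finally show ?thesis by (simp add: P.emeasure_eq_measure Q.emeasure_eq_measure ennreal_leI)
    qed
    ultimately show ?thesis by (auto intro: INF_greatest)
  qed
  have setsP: "sets P = sets (borel_of X)" and setsQ: "sets Q = sets (borel_of X)"
    using P Q by (simp_all add: Prob_def)
  let ?E = "{C. closedin X C}"
  have sub: "?E \<subseteq> Pow (topspace X)" using closedin_subset by blast
  have sig: "sets (borel_of X) = sigma_sets (topspace X) ?E"
  proof (rule antisym)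
    have "U \<in> sigma_sets (topspace X) ?E" if "openin X U" for U
    proof -
      have "topspace X - (topspace X - U) \<in> sigma_sets (topspace X) ?E"
        using that by (intro sigma_sets.Compl sigma_sets.Basic) auto
      then show ?thesis using openin_subset[OF that] by (simp add: double_diff)
    qed
    then show "sets (borel_of X) \<subseteq> sigma_sets (topspace X) ?E"
      unfolding sets_borel_of by (intro sigma_sets_mono) auto
    show "sigma_sets (topspace X) ?E \<subseteq> sets (borel_of X)"
      using closedin_in_borel_of by (intro sets.sigma_sets_subset[of _ "borel_of X", unfolded space_borel_of]) auto
  qed
  show ?thesis
  proof (rule measure_eqI_generator_eq[where E = ?E and \<Omega> = "topspace X" and A = "\<lambda>_. topspace X"])
    show "Int_stable ?E" by (auto intro: Int_stableI closedin_Int)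
    show "emeasure P C = emeasure Q C" if "C \<in> ?E" for C
      using that le[OF P Q _ eq] le[OF Q P _ eq[symmetric]] by (simp add: antisym)
    show "emeasure P (topspace X) \<noteq> \<infinity>" for i :: nat
      using P prob_space.finite_measure finite_measure.emeasure_finite by (auto simp: Prob_def)
  qed (use sub in \<open>auto simp: setsP setsQ sig\<close>)
qed

section \<open>The image of a measure under random maps\<close>

context random_maps
begin

text \<open>Choose a point by \<open>\<alpha>\<close>, then an index by the weights at this point, and apply the map.\<close>

definition push :: "'y measure \<Rightarrow> 'y measure" where
  "push \<alpha> = distr (density (count_space {..<n} \<Otimes>\<^sub>M \<alpha>) (\<lambda>x. ennreal (p (fst x) (snd x)))) \<alpha> (\<lambda>x. T (fst x) (snd x))"

context
  fixes \<alpha> :: "'y measure"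
  assumes \<alpha>: "prob_space \<alpha>" and space: "space \<alpha> = S"
    and T_meas: "\<And>j. j < n \<Longrightarrow> T j \<in> \<alpha> \<rightarrow>\<^sub>M \<alpha>"
    and p_meas: "\<And>j. j < n \<Longrightarrow> p j \<in> borel_measurable \<alpha>"
begin

lemma push_measurable:
  "(\<lambda>x. T (fst x) (snd x)) \<in> count_space {..<n} \<Otimes>\<^sub>M \<alpha> \<rightarrow>\<^sub>M \<alpha>"
  "(\<lambda>x. p (fst x) (snd x)) \<in> borel_measurable (count_space {..<n} \<Otimes>\<^sub>M \<alpha>)"
  by (rule measurable_pair_measure_countable1; simp add: T_meas p_meas)+

lemma prob_space_push: "prob_space (push \<alpha>)"
proof -
  interpret \<alpha>: prob_space \<alpha> by (rule \<alpha>)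
  interpret pair_sigma_finite "count_space {..<n}" \<alpha>
    by (intro pair_sigma_finite.intro sigma_finite_measure_count_space_finite \<alpha>.sigma_finite_measure_axioms) simp
  note [measurable] = push_measurable
  let ?N = "count_space {..<n} \<Otimes>\<^sub>M \<alpha>" and ?p = "\<lambda>x. ennreal (p (fst x) (snd x))"
  have "emeasure (density ?N ?p) (space (density ?N ?p)) = (\<integral>\<^sup>+x. ?p x \<partial>?N)"
    unfolding space_density
    by (subst emeasure_density) (auto intro!: nn_integral_cong)
  also have "\<dots> = (\<integral>\<^sup>+y. (\<integral>\<^sup>+j. ennreal (p j y) \<partial>count_space {..<n}) \<partial>\<alpha>)"
    using nn_integral_snd[of ?p] by simp
  also have "\<dots> = (\<integral>\<^sup>+y. 1 \<partial>\<alpha>)"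
  proof (rule nn_integral_cong)
    fix y assume "y \<in> space \<alpha>"
    then show "(\<integral>\<^sup>+j. ennreal (p j y) \<partial>count_space {..<n}) = 1"
      by (simp add: nn_integral_count_space_finite, subst sum_ennreal)
         (simp_all add: space weight_nonneg weight_sum)
  qed
  also have "\<dots> = 1" by (simp add: \<alpha>.emeasure_space_1)
  finally have "prob_space (density ?N ?p)" by (rule prob_spaceI)
  then show ?thesis
    unfolding push_def by (rule prob_space.prob_space_distr) simp
qed

lemma integral_push:
  assumes g [measurable]: "g \<in> borel_measurable \<alpha>" and G: "\<And>y. y \<in> S \<Longrightarrow> \<bar>g y\<bar> \<le> G"
  shows "(\<integral>y. g y \<partial>push \<alpha>) = (\<integral>y. avg_op g y \<partial>\<alpha>)"
proof -
  interpret \<alpha>: prob_space \<alpha> by (rule \<alpha>)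
  interpret F: finite_measure "count_space {..<n}" by (rule finite_measure_count_space) simp
  interpret pair_sigma_finite "count_space {..<n}" \<alpha> ..
  interpret PF: finite_measure "count_space {..<n} \<Otimes>\<^sub>M \<alpha>"
    by (intro finite_measure_pair_measure F.finite_measure_axioms \<alpha>.finite_measure_axioms)
  note [measurable] = push_measurable
  let ?N = "count_space {..<n} \<Otimes>\<^sub>M \<alpha>"
  have "(\<integral>y. g y \<partial>push \<alpha>) = (\<integral>x. g (T (fst x) (snd x)) \<partial>density ?N (\<lambda>x. ennreal (p (fst x) (snd x))))"
    unfolding push_def by (subst integral_distr) simp_all
  also have "\<dots> = (\<integral>x. p (fst x) (snd x) *\<^sub>R g (T (fst x) (snd x)) \<partial>?N)"
    by (rule integral_density) (auto intro!: AE_I2 simp: space_pair_measure space weight_nonneg)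
  also have "\<dots> = (\<integral>x. (case x of (j, y) \<Rightarrow> p j y * g (T j y)) \<partial>?N)"
    by (intro Bochner_Integration.integral_cong) auto
  also have "\<dots> = (\<integral>y. (\<integral>j. p j y * g (T j y) \<partial>count_space {..<n}) \<partial>\<alpha>)"
  proof (rule integral_snd[symmetric])
    have le1: "p j y \<le> 1" if "j < n" "y \<in> S" for j y
      using member_le_sum[of j "{..<n}" "\<lambda>j. p j y"] that weight_sum weight_nonneg by auto
    show "integrable ?N (\<lambda>(j, y). p j y * g (T j y))"
    proof (rule PF.integrable_const_bound[where B = "1 * G"])
      have "(\<lambda>x. p (fst x) (snd x) * g (T (fst x) (snd x))) \<in> borel_measurable ?N" by measurable
      then show "(\<lambda>(j, y). p j y * g (T j y)) \<in> borel_measurable ?N" by (simp add: case_prod_beta)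
      show "AE x in ?N. norm (case x of (j, y) \<Rightarrow> p j y * g (T j y)) \<le> 1 * G"
      proof (rule AE_I2)
        fix x assume "x \<in> space ?N"
        then obtain j y where x: "x = (j, y)" "j < n" "y \<in> S" by (auto simp: space_pair_measure space)
        have "\<bar>p j y\<bar> * \<bar>g (T j y)\<bar> \<le> 1 * G"
          using x le1 weight_nonneg G maps_into by (intro mult_mono) auto
        then show "norm (case x of (j, y) \<Rightarrow> p j y * g (T j y)) \<le> 1 * G" by (simp add: x abs_mult)
      qed
    qed
  qed
  also have "\<dots> = (\<integral>y. avg_op g y \<partial>\<alpha>)"
    by (simp add: lebesgue_integral_count_space_finite avg_op_def)
  finally show ?thesis .
qed

lemma avg_op_measurable: "g \<in> borel_measurable \<alpha> \<Longrightarrow> avg_op g \<in> borel_measurable \<alpha>"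
  unfolding avg_op_def[abs_def]
  using T_meas p_meas by (intro borel_measurable_sum borel_measurable_times) (auto intro: measurable_compose)

end

end

section \<open>A law of large numbers for orthogonal bounded variables\<close>

text \<open>Averages along the squares control all averages: between \<open>j\<^sup>2\<close> and \<open>(j + 1)\<^sup>2\<close> the partial sums
  of a bounded sequence move by \<open>O(j)\<close>, which is negligible against \<open>j\<^sup>2\<close>.\<close>

lemma averages_tendsto_zero_of_squares:
  fixes a :: "nat \<Rightarrow> real"
  assumes C: "\<And>k. \<bar>a k\<bar> \<le> C"
    and sq: "(\<lambda>j. (\<Sum>k<(Suc j)\<^sup>2. a k) / real ((Suc j)\<^sup>2)) \<longlonglongrightarrow> 0"
  shows "(\<lambda>K. (\<Sum>k<K. a k) / real K) \<longlonglongrightarrow> 0"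
proof -
  define A where "A K = (\<Sum>k<K. a k)" for K
  have C0: "0 \<le> C" using C[of 0] by linarith
  have lip: "\<bar>A K - A J\<bar> \<le> C * (real K - real J)" if "J \<le> K" for J K
  proof -
    have "A K - A J = (\<Sum>k\<in>{J..<K}. a k)"
      unfolding A_def using that by (simp add: lessThan_atLeast0 sum_diff_nat_ivl)
    also have "\<bar>\<dots>\<bar> \<le> (\<Sum>k\<in>{J..<K}. C)"
      by (intro sum_abs[THEN order_trans] sum_mono C)
    finally show ?thesis using that by (simp add: of_nat_diff mult.commute)
  qed
  have sqrt_top: "filterlim floor_sqrt at_top at_top"
    unfolding filterlim_at_top eventually_at_top_linorder
    by (metis floor_sqrt_inverse_power2 mono_floor_sqrt')
  have sq': "(\<lambda>j. A (j\<^sup>2) / real (j\<^sup>2)) \<longlonglongrightarrow> 0"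
    by (rule LIMSEQ_imp_Suc) (use sq in \<open>simp add: A_def\<close>)
  have "(\<lambda>K. A ((floor_sqrt K)\<^sup>2) / real ((floor_sqrt K)\<^sup>2)) \<longlonglongrightarrow> 0"
    using filterlim_compose[OF sq' sqrt_top] .
  then have 1: "(\<lambda>K. \<bar>A ((floor_sqrt K)\<^sup>2) / real ((floor_sqrt K)\<^sup>2)\<bar>) \<longlonglongrightarrow> 0"
    by (rule tendsto_rabs_zero)
  have "(\<lambda>j. 2 * C / real j) \<longlonglongrightarrow> 0"
    by (intro real_tendsto_divide_at_top[OF tendsto_const] filterlim_real_sequentially)
  from filterlim_compose[OF this sqrt_top]
  have 2: "(\<lambda>K. 2 * C / real (floor_sqrt K)) \<longlonglongrightarrow> 0" .
  show ?thesis
  proof (rule Lim_null_comparison)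
    show "(\<lambda>K. \<bar>A ((floor_sqrt K)\<^sup>2) / real ((floor_sqrt K)\<^sup>2)\<bar> + 2 * C / real (floor_sqrt K)) \<longlonglongrightarrow> 0"
      using tendsto_add[OF 1 2] by simp
    show "\<forall>\<^sub>F K in sequentially. norm ((\<Sum>k<K. a k) / real K)
        \<le> \<bar>A ((floor_sqrt K)\<^sup>2) / real ((floor_sqrt K)\<^sup>2)\<bar> + 2 * C / real (floor_sqrt K)"
      using eventually_gt_at_top[of 0]
    proof eventually_elim
      case (elim K)
      define j where "j = floor_sqrt K"
      have j: "0 < j" "j\<^sup>2 \<le> K" "K \<le> j\<^sup>2 + 2 * j"
        using elim Suc_floor_sqrt_power2_gt[of K] floor_sqrt_power2_le[of K]
        unfolding j_def by (simp_all add: power2_eq_square)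
      have "\<bar>A K\<bar> \<le> \<bar>A (j\<^sup>2)\<bar> + C * (real K - real (j\<^sup>2))"
        using lip[OF j(2)] by linarith
      also have "\<dots> \<le> \<bar>A (j\<^sup>2)\<bar> + C * (2 * real j)"
      proof -
        have "real K \<le> real (j\<^sup>2 + 2 * j)" using j(3) by (subst of_nat_le_iff)
        then show ?thesis using C0 by (intro add_left_mono mult_left_mono) auto
      qed
      finally have "\<bar>A K\<bar> / real K \<le> (\<bar>A (j\<^sup>2)\<bar> + C * (2 * real j)) / real K"
        by (intro divide_right_mono) auto
      also have "\<dots> \<le> (\<bar>A (j\<^sup>2)\<bar> + C * (2 * real j)) / real (j\<^sup>2)"
        using j C0 elim by (intro divide_left_mono) (auto simp del: of_nat_power)
      also have "\<dots> = \<bar>A (j\<^sup>2) / real (j\<^sup>2)\<bar> + 2 * C / real j"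
        using j by (simp add: add_divide_distrib power2_eq_square)
      finally show ?case by (simp add: A_def j_def)
    qed
  qed
qed

context prob_space
begin

lemma second_moment_of_orthogonal_sums:
  fixes \<xi> :: "nat \<Rightarrow> 'a \<Rightarrow> real"
  assumes [measurable]: "\<And>k. \<xi> k \<in> borel_measurable M"
    and C: "\<And>k w. w \<in> space M \<Longrightarrow> \<bar>\<xi> k w\<bar> \<le> C"
    and orth: "\<And>k. expectation (\<lambda>w. (\<Sum>i<k. \<xi> i w) * \<xi> k w) = 0"
  shows "expectation (\<lambda>w. (\<Sum>i<K. \<xi> i w)\<^sup>2) \<le> C\<^sup>2 * real K"
proof (induction K)
  case (Suc K)
  have bound: "\<bar>\<Sum>i<k. \<xi> i w\<bar> \<le> real k * C" if "w \<in> space M" for k w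
    using sum_bounded_above[of "{..<k}" "\<lambda>i. \<bar>\<xi> i w\<bar>" C] C[OF that]
    by (intro order_trans[OF sum_abs]) simp
  have sq_le: "x\<^sup>2 \<le> c\<^sup>2" if "\<bar>x\<bar> \<le> c" for x c :: real
    using power_mono[OF that, of 2] by simp
  have i1: "integrable M (\<lambda>w. (\<Sum>i<K. \<xi> i w)\<^sup>2)"
    using sq_le[OF bound] by (intro integrable_const_bound[where B = "(K * C)\<^sup>2"] AE_I2) auto
  have i2: "integrable M (\<lambda>w. (\<xi> K w)\<^sup>2)"
    using sq_le[OF C] by (intro integrable_const_bound[where B = "C\<^sup>2"] AE_I2) auto
  have i3: "integrable M (\<lambda>w. (\<Sum>i<K. \<xi> i w) * \<xi> K w)"
    using bound C by (intro integrable_const_bound[where B = "(K * C) * C"] AE_I2)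
      (auto simp: abs_mult intro!: mult_mono order_trans[OF abs_ge_zero bound])
  have "expectation (\<lambda>w. (\<Sum>i<Suc K. \<xi> i w)\<^sup>2)
      = expectation (\<lambda>w. (\<Sum>i<K. \<xi> i w)\<^sup>2 + 2 * ((\<Sum>i<K. \<xi> i w) * \<xi> K w) + (\<xi> K w)\<^sup>2)"
    by (intro Bochner_Integration.integral_cong) (auto simp: power2_sum)
  also have "\<dots> = expectation (\<lambda>w. (\<Sum>i<K. \<xi> i w)\<^sup>2) + expectation (\<lambda>w. (\<xi> K w)\<^sup>2)"
    using i1 i2 i3 orth by simp
  also have "expectation (\<lambda>w. (\<xi> K w)\<^sup>2) \<le> expectation (\<lambda>w. C\<^sup>2)"
    using sq_le[OF C] i2 by (intro integral_mono) auto
  also have "expectation (\<lambda>w. C\<^sup>2) = C\<^sup>2"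
    by (simp add: prob_space)
  finally show ?case using Suc by (simp add: algebra_simps)
qed simp

text \<open>Orthogonality makes the second moment of the \<open>K\<close>-th average at most \<open>C\<^sup>2 / K\<close>. Along the squares
  these bounds are summable, so there the averages converge to zero almost surely.\<close>

theorem averages_of_orthogonal_tendsto_zero:
  fixes \<xi> :: "nat \<Rightarrow> 'a \<Rightarrow> real"
  assumes [measurable]: "\<And>k. \<xi> k \<in> borel_measurable M"
    and C: "\<And>k w. w \<in> space M \<Longrightarrow> \<bar>\<xi> k w\<bar> \<le> C"
    and orth: "\<And>k. expectation (\<lambda>w. (\<Sum>i<k. \<xi> i w) * \<xi> k w) = 0"
  shows "AE w in M. (\<lambda>K. (\<Sum>k<K. \<xi> k w) / real K) \<longlonglongrightarrow> 0"
proof -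
  define Z where "Z j w = ((\<Sum>k<(Suc j)\<^sup>2. \<xi> k w) / real ((Suc j)\<^sup>2))\<^sup>2" for j w
  have [measurable]: "Z j \<in> borel_measurable M" for j
    unfolding Z_def by measurable
  have Zn: "0 \<le> Z j w" for j w unfolding Z_def by simp
  have bound: "\<bar>\<Sum>i<k. \<xi> i w\<bar> \<le> real k * C" if "w \<in> space M" for k w
    using sum_bounded_above[of "{..<k}" "\<lambda>i. \<bar>\<xi> i w\<bar>" C] C[OF that]
    by (intro order_trans[OF sum_abs]) simp
  have iZ: "integrable M (Z j)" for j
  proof (intro integrable_const_bound[where B = "C\<^sup>2"] AE_I2)
    fix w assume w: "w \<in> space M"
    have "\<bar>(\<Sum>k<(Suc j)\<^sup>2. \<xi> k w) / real ((Suc j)\<^sup>2)\<bar> \<le> C"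
      using bound[OF w, of "(Suc j)\<^sup>2"] by (simp add: field_simps del: of_nat_power of_nat_Suc)
    from power_mono[OF this abs_ge_zero, of 2] show "norm (Z j w) \<le> C\<^sup>2"
      unfolding Z_def power2_abs by simp
  qed simp
  have EZ: "expectation (Z j) \<le> C\<^sup>2 * (1 / real ((Suc j)\<^sup>2))" for j
  proof -
    have "expectation (Z j) = expectation (\<lambda>w. (\<Sum>k<(Suc j)\<^sup>2. \<xi> k w)\<^sup>2) / (real ((Suc j)\<^sup>2))\<^sup>2"
      by (simp add: Z_def[abs_def] power_divide del: of_nat_power)
    also have "\<dots> \<le> (C\<^sup>2 * real ((Suc j)\<^sup>2)) / (real ((Suc j)\<^sup>2))\<^sup>2"
      by (intro divide_right_mono second_moment_of_orthogonal_sums C orth) auto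
    also have "\<dots> = C\<^sup>2 * (1 / real ((Suc j)\<^sup>2))"
      by (simp add: power2_eq_square del: of_nat_power of_nat_Suc)
    finally show ?thesis .
  qed
  have sum_inv: "summable (\<lambda>j. C\<^sup>2 * (1 / real ((Suc j)\<^sup>2)))"
    using inverse_power_summable[of 2, where 'a = real]
    by (intro summable_mult summable_Suc_iff[of "\<lambda>j. 1 / real (j\<^sup>2)", THEN iffD2])
       (simp add: inverse_eq_divide)
  have "(\<integral>\<^sup>+w. (\<Sum>j. ennreal (Z j w)) \<partial>M) = (\<Sum>j. \<integral>\<^sup>+w. ennreal (Z j w) \<partial>M)"
    by (rule nn_integral_suminf) simp
  also have "\<dots> = (\<Sum>j. ennreal (expectation (Z j)))"
    using iZ Zn by (simp add: nn_integral_eq_integral)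
  also have "\<dots> \<le> (\<Sum>j. ennreal (C\<^sup>2 * (1 / real ((Suc j)\<^sup>2))))"
    by (intro suminf_le ennreal_leI EZ) auto
  also have "\<dots> = ennreal (\<Sum>j. C\<^sup>2 * (1 / real ((Suc j)\<^sup>2)))"
    by (intro suminf_ennreal_eq summable_sums sum_inv) auto
  also have "\<dots> < \<infinity>" by simp
  finally have "AE w in M. (\<Sum>j. ennreal (Z j w)) \<noteq> \<infinity>"
    by (intro nn_integral_PInf_AE) auto
  with AE_space show ?thesis
  proof eventually_elim
    case (elim w)
    then have "summable (\<lambda>j. Z j w)"
      by (intro summable_suminf_not_top Zn) simp
    then have "(\<lambda>j. sqrt (Z j w)) \<longlonglongrightarrow> sqrt 0"
      by (intro tendsto_real_sqrt summable_LIMSEQ_zero)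
    then have "(\<lambda>j. \<bar>(\<Sum>k<(Suc j)\<^sup>2. \<xi> k w) / real ((Suc j)\<^sup>2)\<bar>) \<longlonglongrightarrow> 0"
      unfolding Z_def real_sqrt_abs by simp
    then have "(\<lambda>j. (\<Sum>k<(Suc j)\<^sup>2. \<xi> k w) / real ((Suc j)\<^sup>2)) \<longlonglongrightarrow> 0"
      by (rule tendsto_rabs_zero_cancel)
    with C[OF elim(1)] show ?case by (rule averages_tendsto_zero_of_squares)
  qed
qed

end

section \<open>The code space\<close>

lemma topspace_code: "w \<in> topspace (code_topology n) \<longleftrightarrow> (\<forall>i. w i < n)"
  by (auto simp: code_topology_def PiE_iff)

definition code_cylinder :: "nat \<Rightarrow> nat \<Rightarrow> (nat \<Rightarrow> nat) \<Rightarrow> (nat \<Rightarrow> nat) set" where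
  "code_cylinder n N w = {v \<in> topspace (code_topology n). \<forall>i<N. v i = w i}"

definition code_cylinders :: "nat \<Rightarrow> (nat \<Rightarrow> nat) set set" where
  "code_cylinders n = {code_cylinder n N w | N w. w \<in> topspace (code_topology n)}"

lemma openin_code_cylinder:
  assumes "w \<in> topspace (code_topology n)"
  shows "openin (code_topology n) (code_cylinder n N w)"
proof -
  have "code_cylinder n N w = PiE UNIV (\<lambda>i. if i < N then {w i} else {..<n})"
    using assms unfolding code_cylinder_def topspace_code
    by (auto simp: topspace_code PiE_iff split: if_splits)
  moreover have "openin (code_topology n) (PiE UNIV (\<lambda>i. if i < N then {w i} else {..<n}))"
    unfolding code_topology_def openin_PiE_gen
    using assms by (auto simp: topspace_code intro: finite_subset[of _ "{..<N}"])
  ultimately show ?thesis by simp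
qed

lemma countable_code_cylinders: "countable (code_cylinders n)"
proof -
  have "code_cylinders n \<subseteq> range (\<lambda>l. {v \<in> topspace (code_topology n). \<forall>i<length l. v i = l ! i})"
  proof
    fix A assume "A \<in> code_cylinders n"
    then obtain N w where "A = code_cylinder n N w" unfolding code_cylinders_def by blast
    then show "A \<in> range (\<lambda>l. {v \<in> topspace (code_topology n). \<forall>i<length l. v i = l ! i})"
      by (auto simp: code_cylinder_def intro!: image_eqI[of _ _ "map w [0..<N]"])
  qed
  then show ?thesis by (rule countable_subset) auto
qed

lemma openin_code_contains_cylinder:
  assumes U: "openin (code_topology n) U" and w: "w \<in> U"
  obtains N where "code_cylinder n N w \<subseteq> U"
proof -
  from U w obtain V where fin: "finite {i. V i \<noteq> {..<n}}" and V: "w \<in> PiE UNIV V" "PiE UNIV V \<subseteq> U"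
    unfolding code_topology_def openin_product_topology_alt by force
  from fin obtain N where N: "\<And>i. V i \<noteq> {..<n} \<Longrightarrow> i < N"
    unfolding finite_nat_set_iff_bounded by blast
  have "code_cylinder n N w \<subseteq> PiE UNIV V"
  proof
    fix v assume v: "v \<in> code_cylinder n N w"
    have "v i \<in> V i" for i
      using v N[of i] V(1) by (cases "i < N") (auto simp: code_cylinder_def topspace_code PiE_iff)
    then show "v \<in> PiE UNIV V" by (simp add: PiE_iff)
  qed
  then have "code_cylinder n N w \<subseteq> U" using V(2) by (rule subset_trans)
  then show thesis by (rule that)
qed

text \<open>Every open set of sequences is the union of the cylinders that it contains, and there are only
  countably many cylinders.\<close>

lemma sets_code_space: "sets (borel_of (code_topology n)) = sigma_sets (topspace (code_topology n)) (code_cylinders n)"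
proof -
  let ?X = "topspace (code_topology n)"
  have sub: "code_cylinders n \<subseteq> Pow ?X" by (auto simp: code_cylinders_def code_cylinder_def)
  interpret sigma_algebra ?X "sigma_sets ?X (code_cylinders n)"
    by (rule sigma_algebra_sigma_sets[OF sub])
  show ?thesis
    unfolding sets_borel_of
  proof (rule sigma_sets_eqI)
    fix A assume "A \<in> code_cylinders n"
    then show "A \<in> sigma_sets ?X {U. openin (code_topology n) U}"
      unfolding code_cylinders_def using openin_code_cylinder by auto
  next
    fix U assume "U \<in> {U. openin (code_topology n) U}"
    then have U: "openin (code_topology n) U" by simp
    have "U = \<Union>{A \<in> code_cylinders n. A \<subseteq> U}"
    proof (intro subset_antisym subsetI)
      fix w assume w: "w \<in> U"
      with U have top: "w \<in> ?X" using openin_subset by blast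
      from openin_code_contains_cylinder[OF U w] obtain N where "code_cylinder n N w \<subseteq> U" .
      moreover have "code_cylinder n N w \<in> code_cylinders n" "w \<in> code_cylinder n N w"
        using top unfolding code_cylinders_def code_cylinder_def by auto
      ultimately show "w \<in> \<Union>{A \<in> code_cylinders n. A \<subseteq> U}" by blast
    qed auto
    also have "\<dots> \<in> sigma_sets ?X (code_cylinders n)"
      using countable_code_cylinders[of n] by (intro countable_Union) (auto intro: countable_subset)
    finally show "U \<in> sigma_sets ?X (code_cylinders n)" .
  qed
qed

lemma code_cylinder_measurable [measurable]:
  "w \<in> topspace (code_topology n) \<Longrightarrow> code_cylinder n N w \<in> sets (borel_of (code_topology n))"
  unfolding sets_borel_of by (intro sigma_sets.Basic CollectI openin_code_cylinder)

lemma code_cylinder_Int: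
  assumes "w \<in> topspace (code_topology n)" "w' \<in> topspace (code_topology n)"
  shows "code_cylinder n N w \<inter> code_cylinder n N' w' \<in> insert {} (code_cylinders n)"
proof (cases "code_cylinder n N w \<inter> code_cylinder n N' w' = {}")
  case False
  then obtain u where "u \<in> code_cylinder n N w \<inter> code_cylinder n N' w'"
    unfolding ex_in_conv[symmetric] by (elim exE)
  then have u: "u \<in> code_cylinder n N w" "u \<in> code_cylinder n N' w'" by simp_all
  then have "\<forall>i<N. w i = u i" "\<forall>i<N'. w' i = u i"
    by (simp_all add: code_cylinder_def)
  then have "code_cylinder n N w \<inter> code_cylinder n N' w' = code_cylinder n (max N N') u"
    by (auto simp: code_cylinder_def less_max_iff_disj)
  then show ?thesis using u unfolding code_cylinders_def code_cylinder_def by blast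
qed simp

lemma code_measure_unique:
  assumes P: "prob_space P" "sets P = sets (borel_of (code_topology n))"
    and Q: "prob_space Q" "sets Q = sets (borel_of (code_topology n))"
    and eq: "\<And>N w. w \<in> topspace (code_topology n) \<Longrightarrow>
      measure P (code_cylinder n N w) = measure Q (code_cylinder n N w)"
  shows "P = Q"
proof -
  interpret P: prob_space P by fact
  interpret Q: prob_space Q by fact
  let ?X = "topspace (code_topology n)"
  let ?E = "insert {} (code_cylinders n)"
  have sig: "sigma_sets ?X ?E = sigma_sets ?X (code_cylinders n)"
    by (intro sigma_sets_eqI) (auto intro: sigma_sets.Empty)
  have "space P = ?X" using sets_eq_imp_space_eq[OF P(2)] by (simp add: space_borel_of)
  then obtain w where w: "w \<in> ?X" using P.not_empty by blast
  show ?thesis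
  proof (rule measure_eqI_generator_eq[where E = ?E and \<Omega> = ?X and A = "\<lambda>_. ?X"])
    show "Int_stable ?E"
    proof (rule Int_stableI)
      fix A B assume "A \<in> ?E" "B \<in> ?E"
      then consider "A \<inter> B = {}" | "A \<in> code_cylinders n" "B \<in> code_cylinders n" by blast
      then show "A \<inter> B \<in> ?E"
      proof cases
        case 2
        then obtain N w N' w' where "A = code_cylinder n N w" "B = code_cylinder n N' w'"
          "w \<in> ?X" "w' \<in> ?X" unfolding code_cylinders_def by blast
        then show ?thesis using code_cylinder_Int by simp
      qed simp
    qed
    show "?E \<subseteq> Pow ?X" by (auto simp: code_cylinders_def code_cylinder_def)
    show "emeasure P A = emeasure Q A" if "A \<in> ?E" for A
      using that eq by (auto simp: code_cylinders_def P.emeasure_eq_measure Q.emeasure_eq_measure)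
    show "sets P = sigma_sets ?X ?E" "sets Q = sigma_sets ?X ?E"
      by (simp_all add: P Q sig sets_code_space)
    have "?X = code_cylinder n 0 w" by (simp add: code_cylinder_def)
    with w have "?X \<in> ?E" unfolding code_cylinders_def by blast
    then show "range (\<lambda>_. ?X) \<subseteq> ?E" by blast
  qed auto
qed

section \<open>The code measure of random maps\<close>

context random_maps
begin

primrec chain :: "'y \<Rightarrow> (nat \<Rightarrow> nat) \<Rightarrow> nat \<Rightarrow> 'y" where
  "chain y w 0 = y"
| "chain y w (Suc k) = T (w k) (chain y w k)"

lemma chain_cong: "(\<And>i. i < k \<Longrightarrow> v i = w i) \<Longrightarrow> chain y v k = chain y w k"
  by (induction k) auto

lemma chain_in: "y \<in> S \<Longrightarrow> (\<And>i. i < k \<Longrightarrow> w i < n) \<Longrightarrow> chain y w k \<in> S"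
  by (induction k) (auto intro: maps_into)

definition is_code_measure :: "'y \<Rightarrow> (nat \<Rightarrow> nat) measure \<Rightarrow> bool" where
  "is_code_measure y P \<longleftrightarrow> prob_space P \<and> sets P = sets (borel_of (code_topology n)) \<and>
     (\<forall>N. \<forall>w\<in>topspace (code_topology n).
        measure P (code_cylinder n N w) = (\<Prod>j<N. p (w j) (chain y w j)))"

text \<open>The digits are drawn one after the other, the law of the digit number \<open>i\<close> given the earlier ones
  being \<open>j \<mapsto> p j (Y\<^sub>i)\<close>, where \<open>Y\<^sub>i\<close> is the position reached so far. The theorem of Ionescu Tulcea
  assembles these conditional laws.\<close>

lemma ex_is_code_measure:
  assumes y: "y \<in> S"
  shows "\<exists>P. is_code_measure y P"
proof -
  let ?M = "\<lambda>_::nat. count_space {..<n}"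
  define K where "K = (\<lambda>i \<omega>. point_measure {..<n} (\<lambda>j. ennreal (p j (chain y \<omega> i))))"
  have PiM: "PiM {0..<i} ?M = count_space (PiE {0..<i} (\<lambda>_. {..<n}))" for i :: nat
    by (rule count_space_PiM_finite) auto
  have prob: "prob_space (K i \<omega>)" if "\<omega> \<in> PiE {0..<i} (\<lambda>_. {..<n})" for i \<omega>
  proof -
    have "chain y \<omega> i \<in> S" using that by (intro chain_in y) (auto simp: PiE_iff)
    then have "(\<Sum>j<n. ennreal (p j (chain y \<omega> i))) = 1"
      by (subst sum_ennreal) (auto simp: weight_nonneg weight_sum)
    then show ?thesis
      unfolding K_def by (intro prob_spaceI) (simp add: space_point_measure emeasure_point_measure_finite)
  qed
  have K_meas: "K i \<in> PiM {0..<i} ?M \<rightarrow>\<^sub>M subprob_algebra (?M i)" for i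
    unfolding PiM measurable_count_space_eq1
    using prob by (auto simp: space_subprob_algebra K_def sets_point_measure
        intro: prob_space_imp_subprob_space)
  have K_prob: "prob_space (K i \<omega>)" if "\<omega> \<in> space (PiM {0..<i} ?M)" for i \<omega>
    using that by (intro prob) (simp add: PiM)
  interpret IT: Ionescu_Tulcea K ?M
    by (rule Ionescu_Tulcea.intro[OF K_meas K_prob])
  have C: "emeasure (IT.C 0 N (\<lambda>_. undefined)) {restrict w {0..<N}}
      = ennreal (\<Prod>j<N. p (w j) (chain y w j))" if w: "\<And>i. w i < n" for N w
  proof (induction N)
    case 0
    have "restrict w {} = (\<lambda>_. undefined)" by auto
    then show ?case by (simp add: PiM_empty)
  next
    case (Suc N)
    let ?r = "\<lambda>N. restrict w {0..<N}"
    let ?u = "\<lambda>_::nat. undefined :: nat"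
    have u: "?u \<in> space (PiM {0..<0} ?M)" by (simp add: PiM)
    have r: "{?r N} \<in> sets (PiM {0..<N} ?M)" for N using w by (simp add: PiM PiE_iff)
    have sp: "space (IT.C 0 N ?u) = PiE {0..<N} (\<lambda>_. {..<n})"
      using IT.space_C[OF u, of N] by (simp add: PiM)
    have se: "sets (IT.C 0 N ?u) = sets (PiM {0..<N} ?M)"
      using IT.sets_C[OF u, of N] by simp
    have "emeasure (IT.C 0 (Suc N) ?u) {?r (Suc N)}
        = (\<integral>\<^sup>+\<omega>. emeasure (IT.eP N \<omega>) {?r (Suc N)} \<partial>IT.C 0 N ?u)"
      using r[of "Suc N"] IT.measurable_eP[of N] sp w[of 0]
      by (simp, subst emeasure_bind[where N = "PiM {0..<Suc N} ?M"])
         (auto simp: measurable_cong_sets[OF se refl] PiE_eq_empty_iff lessThan_empty_iff)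
    also have "\<dots> = (\<integral>\<^sup>+\<omega>. ennreal (p (w N) (chain y w N)) * indicator {?r N} \<omega> \<partial>IT.C 0 N ?u)"
    proof (rule nn_integral_cong)
      fix \<omega> assume "\<omega> \<in> space (IT.C 0 N ?u)"
      then have \<omega>: "\<omega> \<in> PiE {0..<N} (\<lambda>_. {..<n})" by (simp add: sp)
      have "emeasure (IT.eP N \<omega>) {?r (Suc N)}
          = emeasure (K N \<omega>) ((\<lambda>x. fun_upd \<omega> N x) -` {?r (Suc N)} \<inter> {..<n})"
        using \<omega> r[of "Suc N"] by (subst IT.emeasure_eP) (simp_all add: PiM)
      also have "(\<lambda>x. fun_upd \<omega> N x) -` {?r (Suc N)} \<inter> {..<n} = (if \<omega> = ?r N then {w N} else {})"
      proof -
        have 1: "\<omega> = ?r N" if "fun_upd \<omega> N x = ?r (Suc N)" for x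
        proof
          fix i show "\<omega> i = ?r N i"
            using fun_cong[OF that, of i] \<omega> by (cases "i < N") (auto simp: PiE_iff extensional_def)
        qed
        have 2: "fun_upd (?r N) N x = ?r (Suc N) \<longleftrightarrow> x = w N" for x
          by (auto simp: fun_eq_iff less_Suc_eq)
        show ?thesis
        proof (cases "\<omega> = ?r N")
          case True
          show ?thesis unfolding True vimage_def singleton_iff 2 using w[of N] by auto
        next
          case False
          with 1 have "fun_upd \<omega> N x \<noteq> ?r (Suc N)" for x by metis
          with False show ?thesis by (simp add: vimage_def)
        qed
      qed
      also have "emeasure (K N \<omega>) (if \<omega> = ?r N then {w N} else {})
          = ennreal (p (w N) (chain y w N)) * indicator {?r N} \<omega>"
      proof (cases "\<omega> = ?r N")
        case True
        have "chain y \<omega> N = chain y w N" unfolding True by (rule chain_cong) simp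
        then show ?thesis using True w[of N] by (simp add: K_def emeasure_point_measure_finite)
      qed simp
      finally show "emeasure (IT.eP N \<omega>) {?r (Suc N)}
          = ennreal (p (w N) (chain y w N)) * indicator {?r N} \<omega>" .
    qed
    also have "\<dots> = ennreal (p (w N) (chain y w N)) * ennreal (\<Prod>j<N. p (w j) (chain y w j))"
      using r[of N] by (simp add: nn_integral_cmult_indicator se Suc)
    also have "\<dots> = ennreal (\<Prod>j<Suc N. p (w j) (chain y w j))"
      using w weight_nonneg chain_in y by (subst ennreal_mult[symmetric]) (auto intro!: prod_nonneg simp: mult.commute)
    finally show ?case .
  qed
  let ?P = "IT.PF.lim"
  have space: "PiE UNIV (\<lambda>_::nat. {..<n}) = topspace (code_topology n)"
    by (simp add: code_topology_def)
  have iff: "restrict v {0..<N} = restrict w {0..<N} \<longleftrightarrow> (\<forall>i<N. v i = w i)" for v w :: "nat \<Rightarrow> nat" and N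
  proof
    assume "restrict v {0..<N} = restrict w {0..<N}"
    then show "\<forall>i<N. v i = w i" by (metis atLeastLessThan_iff le0 restrict_apply')
  qed (auto intro: restrict_ext)
  have cyl: "IT.PF.emb UNIV {0..<N} {restrict w {0..<N}} = code_cylinder n N w" for N w
    unfolding prod_emb_def code_cylinder_def by (auto simp: space iff)
  have cyl_meas: "{restrict w {0..<N}} \<in> sets (PiM {0..<N} ?M)" if "\<And>i. w i < n" for N w
    using that by (simp add: PiM PiE_iff)
  have sets: "sets ?P = sets (borel_of (code_topology n))"
  proof
    have "sets ?P = sigma_sets (topspace (code_topology n)) {{f \<in> topspace (code_topology n). f i \<in> A} |i A. A \<subseteq> {..<n}}"
      by (simp add: sets_PiM_single space)
    also have "\<dots> \<subseteq> sets (borel_of (code_topology n))"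
      unfolding sets_borel_of
    proof (rule sigma_sets_mono', safe)
      fix i :: nat and A :: "nat set" assume A: "A \<subseteq> {..<n}"
      have "continuous_map (code_topology n) (discrete_topology {..<n}) (\<lambda>f. f i)"
        unfolding code_topology_def by (rule continuous_map_product_projection) simp
      from openin_continuous_map_preimage[OF this, of A] A
      show "openin (code_topology n) {f \<in> topspace (code_topology n). f i \<in> A}" by simp
    qed
    finally show "sets ?P \<subseteq> sets (borel_of (code_topology n))" .
    have "code_cylinders n \<subseteq> sets ?P"
      unfolding code_cylinders_def
      using cyl_meas by (auto simp: topspace_code simp flip: cyl intro!: measurable_prod_emb)
    moreover have "topspace (code_topology n) = space ?P" by (simp add: space_PiM space)
    ultimately show "sets (borel_of (code_topology n)) \<subseteq> sets ?P"
      unfolding sets_code_space by (metis sets.sigma_sets_subset)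
  qed
  have P_cyl: "emeasure ?P (code_cylinder n N w) = ennreal (\<Prod>j<N. p (w j) (chain y w j))"
    if "w \<in> topspace (code_topology n)" for N w
  proof -
    from that have w: "\<And>i. w i < n" by (simp add: topspace_code)
    have "emeasure ?P (code_cylinder n N w) = emeasure (IT.CI {0..<N}) {restrict w {0..<N}}"
      unfolding cyl[symmetric] by (rule IT.lim) (auto intro: cyl_meas w)
    also have "\<dots> = emeasure (IT.C 0 N (\<lambda>_. undefined)) (IT.PF.emb {0..<N} {0..<N} {restrict w {0..<N}})"
      by (rule IT.emeasure_CI) (auto intro: cyl_meas w)
    also have "IT.PF.emb {0..<N} {0..<N} {restrict w {0..<N}} = {restrict w {0..<N}}"
      using w by (intro prod_emb_id) auto
    also note C[OF w]
    finally show ?thesis .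
  qed
  have "measure ?P (code_cylinder n N w) = (\<Prod>j<N. p (w j) (chain y w j))"
    if "w \<in> topspace (code_topology n)" for N w
    using that P_cyl[OF that] weight_nonneg chain_in y
    by (simp add: measure_def prod_nonneg topspace_code)
  moreover have "prob_space ?P"
  proof
    have "0 < n" using weight_sum[OF y] by (cases n) auto
    then have "(\<lambda>_. 0) \<in> topspace (code_topology n)" by (simp add: topspace_code)
    moreover have "space ?P = code_cylinder n 0 (\<lambda>_. 0)"
      by (simp add: space_PiM space code_cylinder_def)
    ultimately show "emeasure ?P (space ?P) = 1"
      using P_cyl[of "\<lambda>_. 0" 0] by simp
  qed
  ultimately have "is_code_measure y ?P"
    using sets unfolding is_code_measure_def by blast
  then show ?thesis ..
qed

lemma ex1_is_code_measure: "y \<in> S \<Longrightarrow> \<exists>!P. is_code_measure y P"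
  using ex_is_code_measure[of y] code_measure_unique[of _ n]
  by (auto simp: is_code_measure_def)

end

section \<open>The ergodic theorem for the chain\<close>

definition prefix_determined :: "nat \<Rightarrow> ((nat \<Rightarrow> nat) \<Rightarrow> 'b) \<Rightarrow> bool" where
  "prefix_determined N F \<longleftrightarrow> (\<forall>v w. (\<forall>i<N. v i = w i) \<longrightarrow> F v = F w)"

lemma prefix_determined_mono: "prefix_determined M F \<Longrightarrow> M \<le> N \<Longrightarrow> prefix_determined N F"
  unfolding prefix_determined_def by (meson order_less_le_trans)

text \<open>The word \<open>u\<close> is padded by zeros to a sequence in order to name the cylinder that it determines.\<close>

lemma prefix_determined_eq_sum_cylinders:
  fixes F :: "(nat \<Rightarrow> nat) \<Rightarrow> real"
  assumes F: "prefix_determined N F" and v: "v \<in> topspace (code_topology n)"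
  defines "pad \<equiv> \<lambda>u i. if i < N then u i else 0"
  shows "F v = (\<Sum>u\<in>PiE {..<N} (\<lambda>_. {..<n}). F (pad u) * indicator (code_cylinder n N (pad u)) v)"
proof -
  have "(\<Sum>u\<in>PiE {..<N} (\<lambda>_. {..<n}). F (pad u) * indicator (code_cylinder n N (pad u)) v)
      = (\<Sum>u\<in>PiE {..<N} (\<lambda>_. {..<n}). if u = restrict v {..<N} then F v else 0)"
  proof (rule sum.cong[OF refl])
    fix u assume u: "u \<in> PiE {..<N} (\<lambda>_. {..<n})"
    have "v \<in> code_cylinder n N (pad u) \<longleftrightarrow> (\<forall>i<N. v i = u i)"
      using v by (simp add: code_cylinder_def pad_def)
    also have "\<dots> \<longleftrightarrow> u = restrict v {..<N}"
    proof
      assume "\<forall>i<N. v i = u i"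
      with u show "u = restrict v {..<N}"
        by (intro extensionalityI[of _ "{..<N}"]) (auto simp: PiE_iff)
    qed simp
    finally have iff: "v \<in> code_cylinder n N (pad u) \<longleftrightarrow> u = restrict v {..<N}" .
    have "F (pad (restrict v {..<N})) = F v"
      using F unfolding prefix_determined_def by (elim allE impE) (auto simp: pad_def)
    with iff show "F (pad u) * indicator (code_cylinder n N (pad u)) v = (if u = restrict v {..<N} then F v else 0)"
      by (auto simp: indicator_def)
  qed
  also have "\<dots> = F v"
    using v by (subst sum.delta) (auto simp: topspace_code finite_PiE)
  finally show ?thesis ..
qed

lemma prefix_determined_measurable:
  fixes F :: "(nat \<Rightarrow> nat) \<Rightarrow> real"
  assumes F: "prefix_determined N F" and n: "0 < n"
  shows "F \<in> borel_measurable (borel_of (code_topology n))"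
proof -
  have "(\<lambda>v. \<Sum>u\<in>PiE {..<N} (\<lambda>_. {..<n}). F (\<lambda>i. if i < N then u i else 0) *
      indicator (code_cylinder n N (\<lambda>i. if i < N then u i else 0)) v)
      \<in> borel_measurable (borel_of (code_topology n))"
    using n by (intro borel_measurable_sum borel_measurable_times borel_measurable_const
        borel_measurable_indicator code_cylinder_measurable) (auto simp: topspace_code PiE_iff)
  then show ?thesis
    by (rule measurable_cong[THEN iffD1, rotated])
       (simp add: space_borel_of prefix_determined_eq_sum_cylinders[OF F, symmetric])
qed

context random_maps
begin

lemma prefix_determined_chain: "prefix_determined k (\<lambda>w. h (chain y w k))"
  unfolding prefix_determined_def using chain_cong[of k] by metis

lemma n_positive: "y \<in> S \<Longrightarrow> 0 < n"
  using weight_sum[of y] by (cases n) auto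

text \<open>Given the first \<open>N\<close> digits, the position after the next step has the law \<open>j \<mapsto> p j (Y\<^sub>N)\<close>, so the
  difference between a function there and its average from \<open>Y\<^sub>N\<close> is orthogonal to everything that
  these digits determine.\<close>

lemma one_step_orthogonal:
  assumes y: "y \<in> S" and P: "is_code_measure y P" and h: "prefix_determined N h"
  shows "(\<integral>v. h v * (g (chain y v (Suc N)) - avg_op g (chain y v N)) \<partial>P) = 0"
proof -
  interpret P: prob_space P using P by (simp add: is_code_measure_def)
  have sets: "sets P = sets (borel_of (code_topology n))" using P by (simp add: is_code_measure_def)
  have space: "space P = topspace (code_topology n)"
    using sets_eq_imp_space_eq[OF sets] by (simp add: space_borel_of)
  have cyl: "measure P (code_cylinder n N w) = (\<Prod>j<N. p (w j) (chain y w j))"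
    "code_cylinder n N w \<in> sets P" if "w \<in> topspace (code_topology n)" for N w
    using P that by (auto simp: is_code_measure_def sets code_cylinder_measurable)
  let ?\<xi> = "\<lambda>v. g (chain y v (Suc N)) - avg_op g (chain y v N)"
  have zero: "integrable P (\<lambda>v. indicator (code_cylinder n N w) v * ?\<xi> v) \<and>
      (\<integral>v. indicator (code_cylinder n N w) v * ?\<xi> v \<partial>P) = 0"
    if w: "w \<in> topspace (code_topology n)" for w
  proof -
    define z where "z = chain y w N"
    have z: "z \<in> S" unfolding z_def using w y by (intro chain_in) (auto simp: topspace_code)
    have wj: "w(N := j) \<in> topspace (code_topology n)" if "j < n" for j
      using w that by (auto simp: topspace_code)
    have eq: "indicator (code_cylinder n N w) v * ?\<xi> v
        = (\<Sum>j<n. indicator (code_cylinder n (Suc N) (w(N := j))) v * (g (T j z) - avg_op g z))"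
      if v: "v \<in> space P" for v
    proof (cases "v \<in> code_cylinder n N w")
      case True
      then have "chain y v N = z"
        unfolding z_def by (intro chain_cong) (simp add: code_cylinder_def)
      moreover have "v \<in> code_cylinder n (Suc N) (w(N := j)) \<longleftrightarrow> j = v N" for j
        using True by (auto simp: code_cylinder_def less_Suc_eq)
      then have "(\<Sum>j<n. indicator (code_cylinder n (Suc N) (w(N := j))) v * (g (T j z) - avg_op g z))
          = (\<Sum>j<n. if j = v N then g (T j z) - avg_op g z else 0)"
        by (intro sum.cong) (auto simp: indicator_def)
      moreover have "v N < n" using v by (simp add: space topspace_code)
      ultimately show ?thesis using True by simp
    next
      case False
      then have "v \<notin> code_cylinder n (Suc N) (w(N := j))" for j
        by (auto simp: code_cylinder_def less_Suc_eq)
      with False show ?thesis by simp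
    qed
    have int: "integrable P (\<lambda>v. indicator (code_cylinder n (Suc N) (w(N := j))) v * (g (T j z) - avg_op g z))"
      if "j < n" for j
      using cyl(2)[OF wj[OF that]]
      by (intro integrable_mult_left integrable_real_indicator) (auto simp: P.emeasure_eq_measure)
    have prob: "measure P (code_cylinder n (Suc N) (w(N := j))) = (\<Prod>i<N. p (w i) (chain y w i)) * p j z"
      if "j < n" for j
    proof -
      have "chain y (w(N := j)) i = chain y w i" if "i \<le> N" for i
        using that by (intro chain_cong) auto
      then show ?thesis using cyl(1)[OF wj[OF that]] by (simp add: z_def)
    qed
    have "(\<integral>v. indicator (code_cylinder n N w) v * ?\<xi> v \<partial>P)
        = (\<integral>v. (\<Sum>j<n. indicator (code_cylinder n (Suc N) (w(N := j))) v * (g (T j z) - avg_op g z)) \<partial>P)"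
      by (rule Bochner_Integration.integral_cong) (use eq in auto)
    also have "\<dots> = (\<Sum>j<n. measure P (code_cylinder n (Suc N) (w(N := j))) * (g (T j z) - avg_op g z))"
      using int cyl(2)[OF wj] by (subst Bochner_Integration.integral_sum) (auto intro!: sum.cong)
    also have "\<dots> = (\<Prod>i<N. p (w i) (chain y w i)) * (\<Sum>j<n. p j z * (g (T j z) - avg_op g z))"
      using prob by (simp add: sum_distrib_left mult_ac)
    also have "(\<Sum>j<n. p j z * (g (T j z) - avg_op g z)) = 0"
      using weight_sum[OF z] by (simp add: right_diff_distrib sum_subtractf avg_op_def flip: sum_distrib_right)
    finally have "(\<integral>v. indicator (code_cylinder n N w) v * ?\<xi> v \<partial>P) = 0" by simp
    moreover have "integrable P (\<lambda>v. indicator (code_cylinder n N w) v * ?\<xi> v)"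
      by (subst Bochner_Integration.integrable_cong[OF refl eq]) (simp, intro Bochner_Integration.integrable_sum int, simp)
    ultimately show ?thesis by blast
  qed
  let ?W = "PiE {..<N} (\<lambda>_. {..<n})"
  let ?pad = "\<lambda>u i. if i < N then u i else 0"
  have pad: "?pad u \<in> topspace (code_topology n)" if "u \<in> ?W" for u
    using that n_positive[OF y] by (auto simp: topspace_code)
  have "(\<integral>v. h v * ?\<xi> v \<partial>P)
      = (\<integral>v. (\<Sum>u\<in>?W. h (?pad u) * (indicator (code_cylinder n N (?pad u)) v * ?\<xi> v)) \<partial>P)"
    by (intro Bochner_Integration.integral_cong refl, subst prefix_determined_eq_sum_cylinders[OF h, of _ n])
       (auto simp: space sum_distrib_right mult.assoc)
  also have "\<dots> = (\<Sum>u\<in>?W. h (?pad u) * (\<integral>v. indicator (code_cylinder n N (?pad u)) v * ?\<xi> v \<partial>P))"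
    using zero[OF pad] by (subst Bochner_Integration.integral_sum) auto
  also have "\<dots> = 0"
    using zero[OF pad] by simp
  finally show ?thesis .
qed

lemma averages_of_one_step_differences:
  assumes y: "y \<in> S" and P: "is_code_measure y P"
    and G: "\<And>y. y \<in> S \<Longrightarrow> \<bar>g y\<bar> \<le> G"
  shows "AE w in P. (\<lambda>K. (\<Sum>k<K. g (chain y w k) - avg_op g (chain y w k)) / real K) \<longlonglongrightarrow> 0"
proof -
  interpret P: prob_space P using P by (simp add: is_code_measure_def)
  have sets: "sets P = sets (borel_of (code_topology n))" using P by (simp add: is_code_measure_def)
  have space: "space P = topspace (code_topology n)"
    using sets_eq_imp_space_eq[OF sets] by (simp add: space_borel_of)
  have meas: "F \<in> borel_measurable P" if "prefix_determined N F" for F :: "(nat \<Rightarrow> nat) \<Rightarrow> real" and N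
    using prefix_determined_measurable[OF that n_positive[OF y]] by (simp add: measurable_cong_sets[OF sets refl])
  have in_S: "chain y w k \<in> S" if "w \<in> space P" for w k
    using that y by (intro chain_in) (auto simp: space topspace_code)
  define \<xi> where "\<xi> k w = g (chain y w (Suc k)) - avg_op g (chain y w k)" for k w
  have det: "prefix_determined (Suc k) (\<xi> k)" for k
    using prefix_determined_chain[of "Suc k" g y] prefix_determined_mono[OF prefix_determined_chain[of k "avg_op g" y], of "Suc k"]
    unfolding \<xi>_def prefix_determined_def by (metis le_SucI order_refl)
  have detS: "prefix_determined k (\<lambda>w. \<Sum>i<k. \<xi> i w)" for k
    unfolding prefix_determined_def
  proof (intro allI impI sum.cong refl)
    fix v w :: "nat \<Rightarrow> nat" and i assume "\<forall>i<k. v i = w i" "i \<in> {..<k}"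
    then show "\<xi> i v = \<xi> i w" using det[of i] unfolding prefix_determined_def by auto
  qed
  have "AE w in P. (\<lambda>K. (\<Sum>k<K. \<xi> k w) / real K) \<longlonglongrightarrow> 0"
  proof (rule P.averages_of_orthogonal_tendsto_zero)
    show "\<xi> k \<in> borel_measurable P" for k by (rule meas[OF det])
    show "\<bar>\<xi> k w\<bar> \<le> G + G" if "w \<in> space P" for k w
      unfolding \<xi>_def using G[OF in_S[OF that, of "Suc k"]] avg_op_bounded[of g G, OF G in_S[OF that, of k]] by linarith
    show "(\<integral>w. (\<Sum>i<k. \<xi> i w) * \<xi> k w \<partial>P) = 0" for k
      unfolding \<xi>_def[of k] by (rule one_step_orthogonal[OF y P detS])
  qed
  with AE_space show ?thesis
  proof eventually_elim
    case (elim w)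
    have tele: "(\<Sum>k<K. g (chain y w k) - avg_op g (chain y w k))
        = (\<Sum>k<K. \<xi> k w) + (g y - g (chain y w K))" for K
      by (induction K) (auto simp: \<xi>_def)
    have "(\<lambda>K. (g y - g (chain y w K)) / real K) \<longlonglongrightarrow> 0"
    proof (rule Lim_null_comparison)
      show "(\<lambda>K. (G + G) / real K) \<longlonglongrightarrow> 0"
        by (intro real_tendsto_divide_at_top[OF tendsto_const] filterlim_real_sequentially)
      have "norm ((g y - g (chain y w K)) / real K) \<le> (G + G) / real K" for K
      proof -
        have "\<bar>g y - g (chain y w K)\<bar> \<le> G + G"
          using G[OF y] G[OF in_S[OF elim(1), of K]] by linarith
        then show ?thesis by (simp add: divide_right_mono)
      qed
      then show "\<forall>\<^sub>F K in sequentially. norm ((g y - g (chain y w K)) / real K) \<le> (G + G) / real K"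
        by simp
    qed
    from tendsto_add[OF elim(2) this] show ?case
      unfolding tele add_divide_distrib by simp
  qed
qed

text \<open>Along almost every trajectory the averages of \<open>g\<close> agree in the limit with those of each iterate of
  \<open>g\<close> under the averaging operator. If the iterates approach a constant uniformly, it is the limit.\<close>

theorem chain_averages_tendsto:
  assumes y: "y \<in> S" and P: "is_code_measure y P"
    and G: "\<And>y. y \<in> S \<Longrightarrow> \<bar>g y\<bar> \<le> G"
    and c: "\<And>\<epsilon>. 0 < \<epsilon> \<Longrightarrow> \<exists>N. \<forall>y\<in>S. \<bar>(avg_op ^^ N) g y - c\<bar> \<le> \<epsilon>"
  shows "AE w in P. (\<lambda>K. (\<Sum>k<K. g (chain y w k)) / real K) \<longlonglongrightarrow> c"
proof -
  have sets: "sets P = sets (borel_of (code_topology n))" using P by (simp add: is_code_measure_def)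
  have space: "space P = topspace (code_topology n)"
    using sets_eq_imp_space_eq[OF sets] by (simp add: space_borel_of)
  let ?u = "\<lambda>N. (avg_op ^^ N) g"
  have "AE w in P. \<forall>i. (\<lambda>K. (\<Sum>k<K. ?u i (chain y w k) - ?u (Suc i) (chain y w k)) / real K) \<longlonglongrightarrow> 0"
    unfolding AE_all_countable
  proof
    fix i
    show "AE w in P. (\<lambda>K. (\<Sum>k<K. ?u i (chain y w k) - ?u (Suc i) (chain y w k)) / real K) \<longlonglongrightarrow> 0"
      using averages_of_one_step_differences[OF y P, of "?u i" G] avg_op_iterate_bounded[of g G, OF G] by simp
  qed
  with AE_space show ?thesis
  proof eventually_elim
    case (elim w)
    have in_S: "chain y w k \<in> S" for k
      using elim(1) y by (intro chain_in) (auto simp: space topspace_code)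
    have diff: "(\<lambda>K. (\<Sum>k<K. g (chain y w k) - ?u N (chain y w k)) / real K) \<longlonglongrightarrow> 0" for N
    proof (induction N)
      case (Suc N)
      have "(\<lambda>K. (\<Sum>k<K. g (chain y w k) - ?u N (chain y w k)) / real K
          + (\<Sum>k<K. ?u N (chain y w k) - ?u (Suc N) (chain y w k)) / real K) \<longlonglongrightarrow> 0 + 0"
        by (intro tendsto_add Suc elim(2)[rule_format])
      then show ?case by (simp flip: add_divide_distrib sum.distrib)
    qed simp
    show ?case
    proof (rule LIMSEQ_I)
      fix \<epsilon> :: real assume \<epsilon>: "0 < \<epsilon>"
      obtain N where N: "\<And>y. y \<in> S \<Longrightarrow> \<bar>?u N y - c\<bar> \<le> \<epsilon> / 2"
        using c[of "\<epsilon> / 2"] \<epsilon> by auto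
      from LIMSEQ_D[OF diff[of N], of "\<epsilon> / 2"] \<epsilon> obtain K0 where
        K0: "\<And>K. K \<ge> K0 \<Longrightarrow> \<bar>(\<Sum>k<K. g (chain y w k) - ?u N (chain y w k)) / real K\<bar> < \<epsilon> / 2"
        by auto
      show "\<exists>K0. \<forall>K\<ge>K0. norm ((\<Sum>k<K. g (chain y w k)) / real K - c) < \<epsilon>"
      proof (intro exI allI impI)
        fix K assume K: "K \<ge> max K0 1"
        have "(\<Sum>k<K. g (chain y w k)) / real K - c
            = (\<Sum>k<K. g (chain y w k) - ?u N (chain y w k)) / real K + (\<Sum>k<K. ?u N (chain y w k) - c) / real K"
          using K by (simp add: sum_subtractf field_simps)
        moreover have "\<bar>\<Sum>k<K. ?u N (chain y w k) - c\<bar> \<le> (\<Sum>k<K. \<epsilon> / 2)"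
          by (intro order_trans[OF sum_abs] sum_mono N in_S)
        then have "\<bar>(\<Sum>k<K. ?u N (chain y w k) - c) / real K\<bar> \<le> \<epsilon> / 2"
          using K by (simp add: field_simps)
        moreover have "\<bar>(\<Sum>k<K. g (chain y w k) - ?u N (chain y w k)) / real K\<bar> < \<epsilon> / 2"
          using K0[of K] K by linarith
        ultimately show "norm ((\<Sum>k<K. g (chain y w k)) / real K - c) < \<epsilon>"
          unfolding real_norm_def by linarith
      qed
    qed
  qed
qed

end

section \<open>Lipschitz test functions\<close>

text \<open>The cones \<open>max 0 (\<epsilon> - dist z x)\<close> over a finite \<open>\<epsilon>/2\<close>-net have a sum of at least \<open>\<epsilon>/2\<close>, so
  dividing by this sum preserves the Lipschitz property.\<close>

lemma lipschitz_partition_of_unity: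
  assumes comp: "compact (UNIV :: 'a::metric_space set)" and \<epsilon>: "0 < \<epsilon>"
  obtains F :: "'a::metric_space set" and H :: "'a \<Rightarrow> 'a \<Rightarrow> real" and L :: real
  where "finite F" "\<And>z x. 0 \<le> H z x" "\<And>x. (\<Sum>z\<in>F. H z x) = 1"
    "\<And>z x. H z x \<noteq> 0 \<Longrightarrow> dist z x < \<epsilon>"
    "0 \<le> L" "\<And>z x y. z \<in> F \<Longrightarrow> \<bar>H z x - H z y\<bar> \<le> L * dist x y"
proof -
  have "UNIV \<subseteq> (\<Union>z\<in>UNIV. ball z (\<epsilon> / 2) :: 'a set)"
  proof
    fix x :: 'a show "x \<in> (\<Union>z\<in>UNIV. ball z (\<epsilon> / 2))" using \<epsilon> by (intro UN_I[of x]) simp_all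
  qed
  then obtain F :: "'a set" where F: "finite F" "UNIV \<subseteq> (\<Union>z\<in>F. ball z (\<epsilon> / 2))"
    by (rule compactE_image[OF comp, rotated]) simp_all
  define b where "b z x = max 0 (\<epsilon> - dist z x)" for z x :: 'a
  define s where "s x = (\<Sum>z\<in>F. b z x)" for x
  have b0: "0 \<le> b z x" for z x by (simp add: b_def)
  have b_le: "b z x \<le> s x" if "z \<in> F" for z x
    unfolding s_def using F(1) that b0 by (intro member_le_sum) auto
  have s_lower: "\<epsilon> / 2 \<le> s x" for x
  proof -
    from F(2) have "x \<in> (\<Union>z\<in>F. ball z (\<epsilon> / 2))" by blast
    then obtain z where z: "z \<in> F" "dist z x < \<epsilon> / 2" by (auto elim!: UN_E)
    then have "\<epsilon> / 2 \<le> b z x" by (simp add: b_def max_def)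
    with b_le[OF z(1), of x] show ?thesis by linarith
  qed
  have s_pos: "0 < s x" for x using s_lower[of x] \<epsilon> by linarith
  have b_lip: "\<bar>b z x - b z y\<bar> \<le> dist x y" for z x y
    using abs_dist_diff_le[of x z y] by (auto simp: b_def max_def dist_commute)
  have s_lip: "\<bar>s x - s y\<bar> \<le> card F * dist x y" for x y
  proof -
    have "\<bar>s x - s y\<bar> \<le> (\<Sum>z\<in>F. dist x y)"
      unfolding s_def sum_subtractf[symmetric] by (intro order_trans[OF sum_abs] sum_mono b_lip)
    then show ?thesis by simp
  qed
  define L where "L = (1 + card F) * (2 / \<epsilon>)"
  show thesis
  proof (rule that[of F "\<lambda>z x. b z x / s x" L])
    show "0 \<le> b z x / s x" for z x using b0 s_pos[of x] by simp
    show "(\<Sum>z\<in>F. b z x / s x) = 1" for x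
      using s_pos[of x] by (simp add: s_def flip: sum_divide_distrib)
    show "dist z x < \<epsilon>" if "b z x / s x \<noteq> 0" for z x
      using that by (simp add: b_def max_def split: if_splits)
    show "0 \<le> L" unfolding L_def using \<epsilon> by simp
    fix z x y assume z: "z \<in> F"
    have "b z x / s x - b z y / s y = ((b z x - b z y) - (b z y / s y) * (s x - s y)) / s x"
      using s_pos[of x] s_pos[of y] by (simp add: field_simps)
    also have "\<bar>\<dots>\<bar> \<le> (dist x y + 1 * (card F * dist x y)) / s x"
    proof -
      have "\<bar>(b z y / s y) * (s x - s y)\<bar> \<le> 1 * (card F * dist x y)"
        unfolding abs_mult using b0 b_le[OF z, of y] s_pos[of y] s_lip[of x y]
        by (intro mult_mono) auto
      with b_lip[of z x y]
      have "\<bar>(b z x - b z y) - (b z y / s y) * (s x - s y)\<bar> \<le> dist x y + 1 * (card F * dist x y)"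
        by linarith
      then show ?thesis using s_pos[of x] by (simp add: divide_right_mono)
    qed
    also have "\<dots> \<le> (dist x y + 1 * (card F * dist x y)) / (\<epsilon> / 2)"
      using s_lower[of x] s_pos[of x] \<epsilon> by (intro divide_left_mono) auto
    also have "\<dots> = L * dist x y"
      by (simp add: L_def algebra_simps add_divide_distrib)
    finally show "\<bar>b z x / s x - b z y / s y\<bar> \<le> L * dist x y" .
  qed (rule F(1))
qed

text \<open>A continuous function on a compact space is approximated uniformly by combinations of the
  members of fine partitions of unity, so countably many partitions decide the convergence of the
  averages of all continuous functions.\<close>

theorem countable_lipschitz_test_functions:
  assumes comp: "compact (UNIV :: 'a::metric_space set)"
  obtains \<H> :: "('a::metric_space \<Rightarrow> real) set" where "countable \<H>"
    "\<And>h x. h \<in> \<H> \<Longrightarrow> \<bar>h x\<bar> \<le> 1"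
    "\<And>h. h \<in> \<H> \<Longrightarrow> \<exists>L\<ge>0. \<forall>x y. \<bar>h x - h y\<bar> \<le> L * dist x y"
    "\<And>(\<mu> :: 'a measure) a f. \<lbrakk>prob_space \<mu>; sets \<mu> = sets borel; continuous_on UNIV f;
        \<And>h. h \<in> \<H> \<Longrightarrow> (\<lambda>K. (\<Sum>k<K. h (a k)) / real K) \<longlonglongrightarrow> (\<integral>x. h x \<partial>\<mu>)\<rbrakk>
      \<Longrightarrow> (\<lambda>K. (\<Sum>k<K. f (a k)) / real K) \<longlonglongrightarrow> (\<integral>x. (f x :: real) \<partial>\<mu>)"
proof -
  define small_partition where "small_partition N F H L \<longleftrightarrow> finite F \<and> (\<forall>z x. 0 \<le> H z x) \<and> (\<forall>x. (\<Sum>z\<in>F. H z x) = 1) \<and>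
      (\<forall>z x. H z x \<noteq> 0 \<longrightarrow> dist z x < inverse (real (Suc N))) \<and> 0 \<le> L \<and>
      (\<forall>z\<in>F. \<forall>x y. \<bar>H z x - H z y\<bar> \<le> L * dist x y)"
    for N and F :: "'a set" and H :: "'a \<Rightarrow> 'a \<Rightarrow> real" and L :: real
  have "\<exists>F H L. small_partition N F H L" for N
  proof -
    have "0 < inverse (real (Suc N))" by simp
    then obtain F :: "'a set" and H L where
      "finite F" "\<And>z x. 0 \<le> H z x" "\<And>x. (\<Sum>z\<in>F. H z x) = 1"
      "\<And>z x. H z x \<noteq> 0 \<Longrightarrow> dist z x < inverse (real (Suc N))"
      "0 \<le> L" "\<And>z x y. z \<in> F \<Longrightarrow> \<bar>H z x - H z y\<bar> \<le> L * dist x y"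
      by (rule lipschitz_partition_of_unity[OF comp, of "inverse (real (Suc N))"]) metis
    then have "small_partition N F H L" unfolding small_partition_def by blast
    then show ?thesis by blast
  qed
  then obtain F :: "nat \<Rightarrow> 'a set" and H :: "nat \<Rightarrow> 'a \<Rightarrow> 'a \<Rightarrow> real" and L :: "nat \<Rightarrow> real" where
    small_partition: "\<And>N. small_partition N (F N) (H N) (L N)"
    by metis
  have F: "finite (F N)" and H0: "0 \<le> H N z x" and H1: "(\<Sum>z\<in>F N. H N z x) = 1" for N z x
    using small_partition[of N] by (simp_all add: small_partition_def)
  have Hd: "dist z x < inverse (real (Suc N))" if "H N z x \<noteq> 0" for N z x
    using small_partition[of N] that by (simp add: small_partition_def)
  have L: "0 \<le> L N" "z \<in> F N \<Longrightarrow> \<bar>H N z x - H N z y\<bar> \<le> L N * dist x y" for N z x y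
    using small_partition[of N] by (simp_all add: small_partition_def)
  have Hle: "H N z x \<le> 1" if "z \<in> F N" for N z x
    using member_le_sum[of z "F N" "\<lambda>z. H N z x"] that F H0 H1[where N = N and x = x] by auto
  define \<H> where "\<H> = (\<Union>N. H N ` F N)"
  show thesis
  proof (rule that[of \<H>])
    show "countable \<H>" unfolding \<H>_def using F by (auto intro: countable_finite)
    show "\<bar>h x\<bar> \<le> 1" if "h \<in> \<H>" for h x using that H0 Hle by (auto simp: \<H>_def)
    show "\<exists>L\<ge>0. \<forall>x y. \<bar>h x - h y\<bar> \<le> L * dist x y" if "h \<in> \<H>" for h
      using that L unfolding \<H>_def by blast
  next
    fix \<mu> :: "'a measure" and a :: "nat \<Rightarrow> 'a" and f :: "'a \<Rightarrow> real"
    assume \<mu>: "prob_space \<mu>" "sets \<mu> = sets borel" and f: "continuous_on UNIV f"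
      and conv: "\<And>h. h \<in> \<H> \<Longrightarrow> (\<lambda>K. (\<Sum>k<K. h (a k)) / real K) \<longlonglongrightarrow> (\<integral>x. h x \<partial>\<mu>)"
    interpret prob_space \<mu> by fact
    have meas: "g \<in> borel_measurable \<mu>" if "continuous_on UNIV g" for g :: "'a \<Rightarrow> real"
      using borel_measurable_continuous_onI[OF that] by (simp add: measurable_cong_sets[OF \<mu>(2) refl])
    have "compact (f ` UNIV)" by (rule compact_continuous_image[OF f comp])
    then obtain G where G: "\<And>x. \<bar>f x\<bar> \<le> G" using compact_imp_bounded bounded_iff
      by (metis rangeI real_norm_def)
    have int_f: "integrable \<mu> f"
      using G by (intro integrable_const_bound[where B = G] meas f) auto
    have H_cont: "continuous_on UNIV (H N z)" if "z \<in> F N" for N z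
    proof (rule continuous_on_subset[OF lipschitz_on_continuous_on[of "L N"]])
      show "(L N)-lipschitz_on UNIV (H N z)"
        using L that by (intro lipschitz_onI) (auto simp: dist_real_def)
    qed simp
    have int_H: "integrable \<mu> (H N z)" if "z \<in> F N" for N z
      using Hle[OF that] H0 by (intro integrable_const_bound[where B = 1] meas H_cont that) auto
    have unif: "uniformly_continuous_on UNIV f" by (rule compact_uniformly_continuous[OF f comp])
    show "(\<lambda>K. (\<Sum>k<K. f (a k)) / real K) \<longlonglongrightarrow> (\<integral>x. f x \<partial>\<mu>)"
    proof (rule LIMSEQ_I)
      fix \<epsilon> :: real assume \<epsilon>: "0 < \<epsilon>"
      obtain d where d: "0 < d" "\<And>x y. dist x y < d \<Longrightarrow> dist (f x) (f y) < \<epsilon> / 3"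
        using uniformly_continuous_onE[OF unif, of "\<epsilon> / 3"] \<epsilon> by (metis UNIV_I zero_less_divide_iff zero_less_numeral)
      obtain N where N: "inverse (real (Suc N)) < d" using reals_Archimedean[OF d(1)] by blast
      define g where "g x = (\<Sum>z\<in>F N. f z * H N z x)" for x
      have fg: "\<bar>f x - g x\<bar> \<le> \<epsilon> / 3" for x
      proof -
        have "f x - g x = (\<Sum>z\<in>F N. (f x - f z) * H N z x)"
          using H1[where N = N and x = x] by (simp add: g_def left_diff_distrib sum_subtractf flip: sum_distrib_left)
        also have "\<bar>\<dots>\<bar> \<le> (\<Sum>z\<in>F N. \<epsilon> / 3 * H N z x)"
        proof (intro order_trans[OF sum_abs] sum_mono)
          fix z
          show "\<bar>(f x - f z) * H N z x\<bar> \<le> \<epsilon> / 3 * H N z x"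
          proof (cases "H N z x = 0")
            case False
            from Hd[OF this] N have "dist z x < d" by linarith
            from d(2)[OF this] have "\<bar>f x - f z\<bar> \<le> \<epsilon> / 3" by (simp add: dist_real_def abs_minus_commute)
            then have "\<bar>f x - f z\<bar> * H N z x \<le> \<epsilon> / 3 * H N z x" by (intro mult_right_mono H0)
            then show ?thesis by (simp only: abs_mult abs_of_nonneg[OF H0])
          qed simp
        qed
        also have "\<dots> = \<epsilon> / 3" using H1[where N = N and x = x] by (simp flip: sum_divide_distrib sum_distrib_left)
        finally show ?thesis .
      qed
      have int_g: "integrable \<mu> g" unfolding g_def using int_H by auto
      have "(\<lambda>K. \<Sum>z\<in>F N. f z * ((\<Sum>k<K. H N z (a k)) / real K)) \<longlonglongrightarrow> (\<Sum>z\<in>F N. f z * (\<integral>x. H N z x \<partial>\<mu>))"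
        by (intro tendsto_sum tendsto_mult tendsto_const conv) (auto simp: \<H>_def)
      also have "(\<Sum>z\<in>F N. f z * (\<integral>x. H N z x \<partial>\<mu>)) = (\<integral>x. g x \<partial>\<mu>)"
        unfolding g_def using int_H by (subst Bochner_Integration.integral_sum) auto
      also have "(\<lambda>K. \<Sum>z\<in>F N. f z * ((\<Sum>k<K. H N z (a k)) / real K)) = (\<lambda>K. (\<Sum>k<K. g (a k)) / real K)"
        unfolding g_def by (subst sum.swap) (simp add: sum_distrib_left sum_divide_distrib)
      finally have "(\<lambda>K. (\<Sum>k<K. g (a k)) / real K) \<longlonglongrightarrow> (\<integral>x. g x \<partial>\<mu>)" .
      from LIMSEQ_D[OF this, of "\<epsilon> / 3"] \<epsilon> obtain K0 where
        K0: "\<And>K. K \<ge> K0 \<Longrightarrow> \<bar>(\<Sum>k<K. g (a k)) / real K - (\<integral>x. g x \<partial>\<mu>)\<bar> < \<epsilon> / 3" by auto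
      have "(\<integral>x. f x \<partial>\<mu>) - (\<integral>x. g x \<partial>\<mu>) = (\<integral>x. f x - g x \<partial>\<mu>)"
        using int_f int_g by simp
      also have "\<bar>\<dots>\<bar> \<le> (\<integral>x. \<bar>f x - g x\<bar> \<partial>\<mu>)" by (rule integral_abs_bound)
      also have "\<dots> \<le> (\<integral>x. \<epsilon> / 3 \<partial>\<mu>)"
        using int_f int_g fg by (intro integral_mono) auto
      also have "\<dots> = \<epsilon> / 3" by (simp add: prob_space)
      finally have ints: "\<bar>(\<integral>x. f x \<partial>\<mu>) - (\<integral>x. g x \<partial>\<mu>)\<bar> \<le> \<epsilon> / 3" .
      show "\<exists>K0. \<forall>K\<ge>K0. norm ((\<Sum>k<K. f (a k)) / real K - (\<integral>x. f x \<partial>\<mu>)) < \<epsilon>"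
      proof (intro exI[of _ K0] allI impI)
        fix K assume K: "K \<ge> K0"
        have "\<bar>(\<Sum>k<K. f (a k)) - (\<Sum>k<K. g (a k))\<bar> \<le> (\<Sum>k<K. \<epsilon> / 3)"
          unfolding sum_subtractf[symmetric] by (intro order_trans[OF sum_abs] sum_mono fg)
        then have "\<bar>(\<Sum>k<K. f (a k)) / real K - (\<Sum>k<K. g (a k)) / real K\<bar> \<le> \<epsilon> / 3"
          using \<epsilon> by (cases "K = 0") (simp_all add: field_simps flip: diff_divide_distrib)
        with K0[OF K] ints show "norm ((\<Sum>k<K. f (a k)) / real K - (\<integral>x. f x \<partial>\<mu>)) < \<epsilon>"
          unfolding real_norm_def by linarith
      qed
    qed
  qed
qed

section \<open>The space of \<open>m\<close>-tuples\<close>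

lemma topspace_pow_topology: "0 < m \<Longrightarrow> topspace (pow_topology m) = pow_space m"
  unfolding pow_topology_def by (rule Metric_space.topspace_mtopology[OF Metric_space_d_inf])

lemma metrizable_pow_topology: "0 < m \<Longrightarrow> metrizable_space (pow_topology m)"
  unfolding pow_topology_def by (rule Metric_space.metrizable_space_mtopology[OF Metric_space_d_inf])

lemma dist_le_d_inf: "k < m \<Longrightarrow> dist (x k) (y k) \<le> d_inf m x y"
  unfolding d_inf_def by (intro Max_ge) auto

lemma nonexpansive_continuous_map:
  fixes f :: "(nat \<Rightarrow> 'a::metric_space) \<Rightarrow> 'b::metric_space"
  assumes m: "0 < m"
    and f: "\<And>x y. \<lbrakk>x \<in> pow_space m; y \<in> pow_space m\<rbrakk> \<Longrightarrow> dist (f x) (f y) \<le> d_inf m x y"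
  shows "continuous_map (pow_topology m) euclidean f"
proof -
  interpret Metric_space "pow_space m :: (nat \<Rightarrow> 'a) set" "d_inf m" by (rule Metric_space_d_inf[OF m])
  have "openin (pow_topology m) {x \<in> pow_space m. f x \<in> U}" if U: "open U" for U
    unfolding pow_topology_def openin_mtopology
  proof (intro conjI allI impI)
    fix x assume "x \<in> {x \<in> pow_space m. f x \<in> U}"
    then have x: "x \<in> pow_space m" "f x \<in> U" by auto
    then obtain e where e: "0 < e" "ball (f x) e \<subseteq> U" using U open_contains_ball by blast
    have "mball x e \<subseteq> {x \<in> pow_space m. f x \<in> U}"
      using e(2) f[OF x(1)] by (force simp: in_mball)
    with e(1) show "\<exists>r>0. mball x r \<subseteq> {x \<in> pow_space m. f x \<in> U}" by blast
  qed auto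
  then show ?thesis
    by (simp add: continuous_map_def topspace_pow_topology[OF m])
qed

text \<open>The description as a product topology gives compactness by the theorem of Tychonoff and reduces
  the continuity of the extended maps to that of their coordinates.\<close>

lemma pow_topology_eq_product:
  assumes m: "0 < m"
  shows "pow_topology m = product_topology (\<lambda>_. euclidean :: 'a::metric_space topology) {..<m}"
    (is "?A = ?B")
proof -
  interpret Metric_space "pow_space m :: (nat \<Rightarrow> 'a) set" "d_inf m" by (rule Metric_space_d_inf[OF m])
  have "continuous_map ?A ?B (\<lambda>x. x)"
    unfolding continuous_map_componentwise
  proof (intro conjI ballI)
    show "(\<lambda>x. x) ` topspace ?A \<subseteq> extensional {..<m}"
      unfolding topspace_pow_topology[OF m] pow_space_def image_ident by (rule subsetI) (simp add: PiE_iff)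
    show "continuous_map ?A euclidean (\<lambda>x. x k)" if "k \<in> {..<m}" for k
      using that by (intro nonexpansive_continuous_map m dist_le_d_inf) simp
  qed
  from openin_continuous_map_preimage[OF this] have pre: "openin ?A {x \<in> topspace ?A. x \<in> U}" if "openin ?B U" for U
    using that by blast
  have BA: "openin ?A U" if U: "openin ?B U" for U
  proof -
    have "U \<subseteq> topspace ?A"
      using openin_subset[OF U] by (simp add: topspace_pow_topology[OF m] pow_space_def)
    then have "{x \<in> topspace ?A. x \<in> U} = U" by blast
    with pre[OF U] show ?thesis by (rule subst[rotated])
  qed
  have AB: "openin ?B U" if U: "openin ?A U" for U
  proof (subst openin_subopen, intro ballI)
    fix x assume "x \<in> U"
    with U obtain r where r: "0 < r" "mball x r \<subseteq> U"
      unfolding pow_topology_def openin_mtopology by blast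
    have x: "x \<in> pow_space m" using U \<open>x \<in> U\<close> openin_subset topspace_pow_topology[OF m] by blast
    let ?V = "PiE {..<m} (\<lambda>k. ball (x k) r)"
    have "openin ?B ?V" by (simp add: openin_PiE)
    moreover have "x \<in> ?V" using x r(1) by (auto simp: pow_space_def PiE_iff)
    moreover have "?V \<subseteq> mball x r"
    proof
      fix y assume y: "y \<in> ?V"
      then have "d_inf m x y < r"
        unfolding d_inf_def using m by (subst Max_less_iff) (auto simp: PiE_iff)
      moreover have "y \<in> pow_space m" using y by (simp add: pow_space_def PiE_iff)
      ultimately show "y \<in> mball x r" using x by (simp add: in_mball)
    qed
    ultimately show "\<exists>T. openin ?B T \<and> x \<in> T \<and> T \<subseteq> U" using r(2) by blast
  qed
  show ?thesis unfolding topology_eq using AB BA by blast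
qed

lemma compact_pow_topology:
  assumes "0 < m" "compact (UNIV :: 'a::metric_space set)"
  shows "compact_space (pow_topology m :: (nat \<Rightarrow> 'a) topology)"
proof -
  have "compact_space (euclidean :: 'a topology)" using assms(2) by (simp add: compact_space_def)
  then show ?thesis by (simp add: pow_topology_eq_product[OF assms(1)] compact_space_product_topology)
qed

lemma extension_in_pow_space: "extension m h x \<in> pow_space m"
  by (simp add: extension_def pow_space_def)

lemma continuous_map_extension:
  assumes m: "0 < m" and h: "continuous_map (pow_topology m) euclidean (h :: (nat \<Rightarrow> 'a::metric_space) \<Rightarrow> 'a)"
  shows "continuous_map (pow_topology m) (pow_topology m) (extension m h)"
proof -
  have "continuous_map (pow_topology m) euclidean (\<lambda>x. extension m h x k)" if k: "k < m" for k
  proof (cases "k = m - 1")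
    case True
    with k h show ?thesis by (simp add: extension_def)
  next
    case False
    with k have "Suc k < m" by simp
    then have "continuous_map (pow_topology m) euclidean (\<lambda>x. x (Suc k) :: 'a)"
      by (intro nonexpansive_continuous_map m dist_le_d_inf)
    with False k show ?thesis by (simp add: extension_def)
  qed
  then have "continuous_map (pow_topology m) (product_topology (\<lambda>_. euclidean) {..<m}) (extension m h)"
    unfolding continuous_map_componentwise by (auto simp: extension_def)
  then show ?thesis by (simp add: pow_topology_eq_product[OF m])
qed

lemma orbit_initial: "k < m \<Longrightarrow> orbit m \<phi> x w k = x k"
  by (subst orbit.simps) simp

lemma orbit_window_0: "x \<in> pow_space m \<Longrightarrow> orbit_window m \<phi> x w 0 = x"
  by (rule extensionalityI[of _ "{..<m}"])
     (simp_all add: orbit_window_def orbit_initial pow_space_def PiE_iff)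

lemma orbit_window_Suc:
  assumes "0 < m"
  shows "orbit_window m \<phi> x w (Suc k) = extension m (\<phi> (w k)) (orbit_window m \<phi> x w k)"
proof (rule extensionalityI[of _ "{..<m}"])
  fix i assume "i \<in> {..<m}"
  then have i: "i < m" by simp
  show "orbit_window m \<phi> x w (Suc k) i = extension m (\<phi> (w k)) (orbit_window m \<phi> x w k) i"
  proof (cases "i = m - 1")
    case True
    then have e: "Suc k + i = k + m" using assms by simp
    have "orbit m \<phi> x w (k + m) = \<phi> (w k) (orbit_window m \<phi> x w k)"
      by (subst orbit.simps) (simp add: orbit_window_def)
    moreover have "orbit_window m \<phi> x w (Suc k) i = orbit m \<phi> x w (k + m)"
      using i by (simp only: orbit_window_def restrict_apply lessThan_iff if_True e)
    ultimately show ?thesis using True i by (simp add: extension_def)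
  next
    case False
    with i have "Suc i < m" by simp
    with False i show ?thesis by (simp add: orbit_window_def extension_def)
  qed
qed (simp_all add: orbit_window_def extension_def)

section \<open>The projected Hutchinson measure\<close>

locale contractive_gifspdp =
  fixes m n :: nat
    and \<phi> :: "nat \<Rightarrow> (nat \<Rightarrow> 'a::metric_space) \<Rightarrow> 'a"
    and p :: "nat \<Rightarrow> (nat \<Rightarrow> 'a) \<Rightarrow> real"
  assumes m: "0 < m"
    and compact: "compact (UNIV :: 'a set)"
    and gifspdp: "gifspdp m n \<phi> p"
    and E1: "E1 m n \<phi>"
    and E2: "E2 m n p"
begin

sublocale random_maps "pow_space m" n "\<lambda>j. extension m (\<phi> j)" p
  using gifspdp by unfold_locales (auto simp: gifspdp_def extension_in_pow_space)

lemma transfer_op_eq_avg_op: "transfer_op m n \<phi> p = avg_op"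
  by (simp add: transfer_op_def avg_op_def fun_eq_iff)

lemma chain_eq_orbit_window: "x \<in> pow_space m \<Longrightarrow> chain x w k = orbit_window m \<phi> x w k"
  by (induction k) (simp_all add: orbit_window_0 orbit_window_Suc[OF m])

text \<open>The windows of the orbit are the trajectory of the extended system, so the measure of the
  statement is the code measure of the random maps.\<close>

lemma is_code_measure_code_measure:
  assumes x: "x \<in> pow_space m"
  shows "is_code_measure x (code_measure m n \<phi> p x)"
proof -
  have "code_measure m n \<phi> p x = (THE P. is_code_measure x P)"
    unfolding code_measure_def is_code_measure_def code_cylinder_def chain_eq_orbit_window[OF x] ..
  then show ?thesis using theI'[OF ex1_is_code_measure[OF x]] by simp
qed

lemma n_pos: "0 < n"
proof -
  have "restrict (\<lambda>_. undefined) {..<m} \<in> (pow_space m :: (nat \<Rightarrow> 'a) set)"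
    by (simp add: pow_space_def)
  then show ?thesis by (rule n_positive)
qed

text \<open>The extended maps only shift all coordinates but the last, so they do not contract the maximum
  metric. Giving the coordinate number \<open>k\<close> the weight \<open>\<theta> ^ k\<close> with \<open>\<theta> > 1\<close> makes the shift contract
  by \<open>1 / \<theta>\<close>; the new last coordinate, which carries the largest weight, contracts by
  \<open>\<theta> ^ (m - 1) * \<kappa>\<close>, where \<open>\<kappa>\<close> bounds the sums of the Lipschitz coefficients. The choice
  \<open>\<theta> ^ m = 1 / \<kappa>\<close> makes both factors equal.\<close>

lemma ex_contracting_distance:
  obtains \<rho> q \<delta> D where "contracting_random_maps (pow_space m) n (\<lambda>j. extension m (\<phi> j)) p \<rho> q 1 \<delta> D"
    "\<And>x y. dist (x 0) (y 0) \<le> \<rho> x y"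
proof -
  from E1 have "\<forall>j\<in>{..<n}. \<exists>a. (\<forall>k<m. a k > 0) \<and> (\<Sum>k<m. a k) < 1 \<and> (\<forall>x\<in>pow_space m. \<forall>y\<in>pow_space m.
      dist (\<phi> j x) (\<phi> j y) \<le> (\<Sum>k<m. a k * dist (x k) (y k)))"
    by (simp add: E1_def)
  from bchoice[OF this] obtain a where
    a: "\<forall>j\<in>{..<n}. (\<forall>k<m. a j k > 0) \<and> (\<Sum>k<m. a j k) < 1 \<and> (\<forall>x\<in>pow_space m. \<forall>y\<in>pow_space m.
      dist (\<phi> j x) (\<phi> j y) \<le> (\<Sum>k<m. a j k * dist (x k) (y k)))"
    by (elim exE)
  have a_pos: "0 < a j k" if "j < n" "k < m" for j k using bspec[OF a, of j] that by simp
  have a_sum: "(\<Sum>k<m. a j k) < 1" if "j < n" for j using bspec[OF a, of j] that by simp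
  have a_lip: "dist (\<phi> j x) (\<phi> j y) \<le> (\<Sum>k<m. a j k * dist (x k) (y k))"
    if "j < n" "x \<in> pow_space m" "y \<in> pow_space m" for j x y using bspec[OF a, of j] that by simp
  \<comment> \<open>The entry \<open>1/2\<close> keeps \<open>\<kappa>\<close> away from zero, so that \<open>\<theta>\<close> exists.\<close>
  define \<kappa> where "\<kappa> = Max (insert (1/2) ((\<lambda>j. \<Sum>k<m. a j k) ` {..<n}))"
  have \<kappa>1: "\<kappa> < 1" unfolding \<kappa>_def using a_sum by (subst Max_less_iff) auto
  have \<kappa>0: "1/2 \<le> \<kappa>" unfolding \<kappa>_def by (rule Max_ge) auto
  have \<kappa>: "(\<Sum>k<m. a j k) \<le> \<kappa>" if "j < n" for j unfolding \<kappa>_def using that by (intro Max_ge) auto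
  define \<theta> where "\<theta> = root m (1 / \<kappa>)"
  have \<theta>: "1 < \<theta>" unfolding \<theta>_def using m \<kappa>0 \<kappa>1 by simp
  have \<theta>m: "\<theta> ^ m = 1 / \<kappa>" unfolding \<theta>_def using m \<kappa>0 by (intro real_root_pow_pos2) auto
  define \<rho> where "\<rho> x y = Max ((\<lambda>k. \<theta> ^ k * dist (x k) (y k)) ` {..<m})" for x y :: "nat \<Rightarrow> 'a"
  have le: "\<theta> ^ k * dist (x k) (y k) \<le> \<rho> x y" if "k < m" for k x y
    unfolding \<rho>_def using that by (intro Max_ge) auto
  have least: "\<rho> x y \<le> b" if "\<And>k. k < m \<Longrightarrow> \<theta> ^ k * dist (x k) (y k) \<le> b" for x y b
    unfolding \<rho>_def using that m by (subst Max_le_iff) auto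
  have dist_le_\<rho>: "dist (x k) (y k) \<le> \<rho> x y" if "k < m" for k x y
  proof -
    have "1 * dist (x k) (y k) \<le> \<theta> ^ k * dist (x k) (y k)"
      using \<theta> by (intro mult_right_mono one_le_power) auto
    with le[OF that, of x y] show ?thesis by linarith
  qed
  have \<rho>0: "0 \<le> \<rho> x y" for x y
    using dist_le_\<rho>[OF m, of x y] zero_le_dist[of "x 0" "y 0"] by linarith
  have weighted_sum: "(\<Sum>k<m. c k * dist (x k) (y k)) \<le> (\<Sum>k<m. c k) * \<rho> x y"
    if "\<And>k. k < m \<Longrightarrow> 0 < c k" for c x y
    unfolding sum_distrib_right using that dist_le_\<rho>
    by (intro sum_mono mult_left_mono) (auto intro: less_imp_le)
  define D where "D = \<theta> ^ m * diameter (UNIV :: 'a set)"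
  from E2 obtain \<delta> where \<delta>: "0 < \<delta>" "\<And>j x. \<lbrakk>j < n; x \<in> pow_space m\<rbrakk> \<Longrightarrow> \<delta> \<le> p j x"
    unfolding E2_def by blast
  show thesis
  proof (rule that[of \<rho> "1 / \<theta>" \<delta> D])
    show "contracting_random_maps (pow_space m) n (\<lambda>j. extension m (\<phi> j)) p \<rho> (1 / \<theta>) 1 \<delta> D"
    proof unfold_locales
      fix x y :: "nat \<Rightarrow> 'a"
      show "\<rho> x y \<le> D"
      proof (rule least)
        fix k assume "k < m"
        then have "\<theta> ^ k \<le> \<theta> ^ m" using \<theta> by (intro power_increasing) auto
        moreover have "dist (x k) (y k) \<le> diameter (UNIV :: 'a set)"
          using compact_imp_bounded[OF compact] by (intro diameter_bounded_bound) auto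
        ultimately show "\<theta> ^ k * dist (x k) (y k) \<le> D"
          unfolding D_def using \<theta> by (intro mult_mono) auto
      qed
    next
      fix j and x y :: "nat \<Rightarrow> 'a"
      assume j: "j < n" and x: "x \<in> pow_space m" and y: "y \<in> pow_space m"
      show "\<rho> (extension m (\<phi> j) x) (extension m (\<phi> j) y) \<le> 1 / \<theta> * \<rho> x y"
      proof (rule least)
        fix k assume k: "k < m"
        show "\<theta> ^ k * dist (extension m (\<phi> j) x k) (extension m (\<phi> j) y k) \<le> 1 / \<theta> * \<rho> x y"
        proof (cases "k = m - 1")
          case True
          have "dist (\<phi> j x) (\<phi> j y) \<le> (\<Sum>k<m. a j k) * \<rho> x y"
            using a_lip[OF j x y] weighted_sum[of "a j" x y, OF a_pos[OF j]] by linarith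
          also have "\<dots> \<le> \<kappa> * \<rho> x y" by (intro mult_right_mono \<kappa> j \<rho>0)
          finally have "\<theta> ^ k * dist (\<phi> j x) (\<phi> j y) \<le> \<theta> ^ k * (\<kappa> * \<rho> x y)"
            using \<theta> by (intro mult_left_mono) auto
          also have "\<theta> ^ k * (\<kappa> * \<rho> x y) = 1 / \<theta> * \<rho> x y"
          proof -
            have "\<theta> ^ Suc k = 1 / \<kappa>" using \<theta>m True m by simp
            then show ?thesis using \<theta> \<kappa>0 by (simp add: field_simps)
          qed
          finally show ?thesis using True k by (simp add: extension_def)
        next
          case False
          with k have "Suc k < m" by simp
          from le[OF this, of x y] have "\<theta> ^ k * dist (x (Suc k)) (y (Suc k)) \<le> 1 / \<theta> * \<rho> x y"
            using \<theta> by (simp add: field_simps)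
          with False k show ?thesis by (simp add: extension_def)
        qed
      qed
      from E2 j obtain c where c: "\<forall>k<m. 0 < c k" "(\<Sum>k<m. c k) < 1"
        "\<bar>p j x - p j y\<bar> \<le> (\<Sum>k<m. c k * dist (x k) (y k))"
        unfolding E2_def using x y by blast
      have "(\<Sum>k<m. c k) * \<rho> x y \<le> 1 * \<rho> x y"
        using c(2) \<rho>0 by (intro mult_right_mono) auto
      with c(3) weighted_sum[of c x y] c(1) show "\<bar>p j x - p j y\<bar> \<le> 1 * \<rho> x y"
        by simp
    qed (use \<theta> \<rho>0 n_pos \<delta> in auto)
  qed (rule dist_le_\<rho>[OF m])
qed

lemma continuous_map_weight:
  assumes j: "j < n"
  shows "continuous_map (pow_topology m) euclideanreal (p j)"
proof (rule nonexpansive_continuous_map[OF m])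
  fix x y :: "nat \<Rightarrow> 'a" assume xy: "x \<in> pow_space m" "y \<in> pow_space m"
  from E2 j xy obtain c where c: "\<forall>k<m. 0 < c k" "(\<Sum>k<m. c k) < 1"
    "\<bar>p j x - p j y\<bar> \<le> (\<Sum>k<m. c k * dist (x k) (y k))"
    unfolding E2_def by blast
  have "(\<Sum>k<m. c k * dist (x k) (y k)) \<le> (\<Sum>k<m. c k) * d_inf m x y"
    unfolding sum_distrib_right using c(1) dist_le_d_inf
    by (intro sum_mono mult_left_mono) (auto intro: less_imp_le)
  also have "\<dots> \<le> 1 * d_inf m x y"
    using c(2) dist_le_d_inf[OF m, of x y] zero_le_dist[of "x 0" "y 0"] by (intro mult_right_mono) linarith+
  finally show "dist (p j x) (p j y) \<le> d_inf m x y"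
    using c(3) by (simp add: dist_real_def)
qed

context
  fixes \<alpha> :: "(nat \<Rightarrow> 'a) measure"
  assumes \<alpha>: "\<alpha> \<in> Prob (pow_topology m)"
begin

lemma prob_space_\<alpha>: "prob_space \<alpha>" and sets_\<alpha>: "sets \<alpha> = sets (borel_of (pow_topology m))"
  using \<alpha> by (simp_all add: Prob_def)

lemma space_\<alpha>: "space \<alpha> = pow_space m"
  using sets_eq_imp_space_eq[OF sets_\<alpha>] by (simp add: space_borel_of topspace_pow_topology[OF m])

lemma continuous_map_measurable_\<alpha>:
  "continuous_map (pow_topology m) euclidean f \<Longrightarrow> f \<in> borel_measurable \<alpha>"
  using continuous_map_borel_measurable measurable_cong_sets[OF sets_\<alpha> refl] by blast

lemma extension_measurable_\<alpha>: "j < n \<Longrightarrow> extension m (\<phi> j) \<in> \<alpha> \<rightarrow>\<^sub>M \<alpha>"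
  using continuous_map_measurable_borel_of[OF continuous_map_extension[OF m], of "\<phi> j"] gifspdp
  by (simp add: measurable_cong_sets[OF sets_\<alpha> sets_\<alpha>] gifspdp_def)

lemma weight_measurable_\<alpha>: "j < n \<Longrightarrow> p j \<in> borel_measurable \<alpha>"
  by (intro continuous_map_measurable_\<alpha> continuous_map_weight)

lemma coordinate_measurable_\<alpha>: "k < m \<Longrightarrow> (\<lambda>x. x k) \<in> borel_measurable \<alpha>"
  by (intro continuous_map_measurable_\<alpha> nonexpansive_continuous_map m dist_le_d_inf)

lemmas push_facts = prob_space_\<alpha> space_\<alpha> extension_measurable_\<alpha> weight_measurable_\<alpha>

text \<open>The definite description in the definition of the Markov operator is resolved by exhibiting a
  measure with the required integrals; it is regular because the space is compact and metrizable,
  and it is the only one because continuous functions determine a regular measure. From here on the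
  invariance of \<open>\<alpha>\<close> may be used for bounded Borel functions, in particular for indicators.\<close>

lemma markov_op_eq_push: "markov_op m n \<phi> p \<alpha> = push \<alpha>"
  unfolding markov_op_def transfer_op_eq_avg_op
proof (rule the_equality)
  have sets: "sets (push \<alpha>) = sets (borel_of (pow_topology m))" by (simp add: push_def sets_\<alpha>)
  have prob: "prob_space (push \<alpha>)" by (rule prob_space_push[OF push_facts])
  have Prob: "push \<alpha> \<in> Prob (pow_topology m)"
    unfolding Prob_def
    using prob sets finite_borel_measure_regular[OF metrizable_pow_topology[OF m] compact_pow_topology[OF m compact]]
    by (simp add: prob_space.finite_measure)
  have int: "(\<integral>x. g x \<partial>push \<alpha>) = (\<integral>x. avg_op g x \<partial>\<alpha>)"
    if g: "continuous_map (pow_topology m) euclideanreal g" for g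
  proof -
    have "compactin euclideanreal (g ` topspace (pow_topology m))"
      using compact_pow_topology[OF m compact] unfolding compact_space_def by (rule image_compactin[OF _ g])
    then have "bounded (g ` pow_space m)"
      by (simp add: topspace_pow_topology[OF m] compact_imp_bounded)
    then obtain G where G: "\<And>x. x \<in> pow_space m \<Longrightarrow> \<bar>g x\<bar> \<le> G" by (auto simp: bounded_iff)
    show ?thesis
      by (rule integral_push[OF push_facts continuous_map_measurable_\<alpha>[OF g] G])
  qed
  show "push \<alpha> \<in> Prob (pow_topology m) \<and> (\<forall>g. continuous_map (pow_topology m) euclideanreal g \<longrightarrow>
      (\<integral>x. g x \<partial>push \<alpha>) = (\<integral>x. avg_op g x \<partial>\<alpha>))"
    using Prob int by blast
  show "\<beta> = push \<alpha>" if "\<beta> \<in> Prob (pow_topology m) \<and> (\<forall>g. continuous_map (pow_topology m) euclideanreal g \<longrightarrow>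
      (\<integral>x. g x \<partial>\<beta>) = (\<integral>x. avg_op g x \<partial>\<alpha>))" for \<beta>
    using that int by (intro Prob_eqI_continuous[OF metrizable_pow_topology[OF m] _ Prob]) auto
qed

end

context
  fixes \<alpha> :: "(nat \<Rightarrow> 'a) measure"
  assumes hutchinson: "extended_hutchinson_measure m n \<phi> p \<alpha>"
begin

lemma \<alpha>_Prob: "\<alpha> \<in> Prob (pow_topology m)" and push_invariant: "push \<alpha> = \<alpha>"
  using hutchinson markov_op_eq_push by (auto simp: extended_hutchinson_measure_def)

lemma integral_avg_op_iterate:
  assumes g: "g \<in> borel_measurable \<alpha>" and G: "\<And>y. y \<in> pow_space m \<Longrightarrow> \<bar>g y\<bar> \<le> G"
  shows "(avg_op ^^ N) g \<in> borel_measurable \<alpha> \<and> (\<integral>y. (avg_op ^^ N) g y \<partial>\<alpha>) = (\<integral>y. g y \<partial>\<alpha>)"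
proof (induction N)
  case (Suc N)
  let ?u = "(avg_op ^^ N) g"
  have u: "?u \<in> borel_measurable \<alpha>" using Suc by blast
  have "(\<integral>y. ?u y \<partial>push \<alpha>) = (\<integral>y. avg_op ?u y \<partial>\<alpha>)"
    using integral_push[OF push_facts[OF \<alpha>_Prob] u] avg_op_iterate_bounded[of g G, OF G] by blast
  with Suc show ?case
    using avg_op_measurable[OF push_facts[OF \<alpha>_Prob] u] by (simp add: push_invariant)
qed (use g in simp)

text \<open>One step of the system moves the coordinate number \<open>k + 1\<close> to the place \<open>k\<close>, so invariance
  identifies their laws.\<close>

lemma marginal_Suc:
  assumes k: "Suc k < m"
  shows "marginal k \<alpha> = marginal (Suc k) \<alpha>"
proof (rule measure_eqI)
  interpret prob_space \<alpha> by (rule prob_space_\<alpha>[OF \<alpha>_Prob])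
  note meas = coordinate_measurable_\<alpha>[OF \<alpha>_Prob]
  fix B assume "B \<in> sets (marginal k \<alpha>)"
  then have B: "B \<in> sets borel" by (simp add: marginal_def)
  have emeasure_marginal: "emeasure (marginal i \<alpha>) B = ennreal (\<integral>x. indicator B (x i) \<partial>\<alpha>)" if i: "i < m" for i
  proof -
    let ?A = "(\<lambda>x. x i) -` B \<inter> space \<alpha>"
    have "emeasure (marginal i \<alpha>) B = ennreal (measure \<alpha> ?A)"
      unfolding marginal_def by (simp add: emeasure_distr[OF meas[OF i] B] emeasure_eq_measure)
    also have "measure \<alpha> ?A = (\<integral>x. indicator ?A x \<partial>\<alpha>)"
      using measurable_sets[OF meas[OF i] B] by simp
    also have "\<dots> = (\<integral>x. indicator B (x i) \<partial>\<alpha>)"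
      by (intro Bochner_Integration.integral_cong) (auto simp: indicator_def)
    finally show ?thesis .
  qed
  let ?g = "\<lambda>x. indicator B (x k) :: real"
  have g: "?g \<in> borel_measurable \<alpha>"
    using measurable_compose[OF meas[of k] borel_measurable_indicator[OF B]] k by simp
  have "(\<integral>x. ?g x \<partial>\<alpha>) = (\<integral>x. ?g x \<partial>push \<alpha>)" by (simp add: push_invariant)
  also have "\<dots> = (\<integral>x. avg_op ?g x \<partial>\<alpha>)"
    by (rule integral_push[OF push_facts[OF \<alpha>_Prob] g, of 1]) (auto simp: indicator_def)
  also have "\<dots> = (\<integral>x. indicator B (x (Suc k)) \<partial>\<alpha>)"
  proof (intro Bochner_Integration.integral_cong refl)
    fix x assume "x \<in> space \<alpha>"
    then have x: "x \<in> pow_space m" by (simp add: space_\<alpha>[OF \<alpha>_Prob])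
    have "extension m (\<phi> j) x k = x (Suc k)" for j
      using k by (auto simp: extension_def)
    then have "avg_op ?g x = (\<Sum>j<n. p j x) * indicator B (x (Suc k))"
      unfolding avg_op_def sum_distrib_right by simp
    then show "avg_op ?g x = indicator B (x (Suc k))" by (simp add: weight_sum[OF x])
  qed
  finally show "emeasure (marginal k \<alpha>) B = emeasure (marginal (Suc k) \<alpha>) B"
    using k by (simp add: emeasure_marginal)
qed (simp add: marginal_def)

lemma marginal_eq_marginal_0: "k < m \<Longrightarrow> marginal k \<alpha> = marginal 0 \<alpha>"
  by (induction k) (simp_all add: marginal_Suc[symmetric])

text \<open>The iterates of a Lipschitz function flatten out, and invariance identifies the constant that
  they approach as the integral.\<close>

lemma lipschitz_orbit_averages:
  assumes x: "x \<in> pow_space m"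
    and h: "\<And>z. \<bar>h z\<bar> \<le> 1" and L: "0 \<le> L" "\<And>z z'. \<bar>h z - h z'\<bar> \<le> L * dist z z'"
  shows "AE w in code_measure m n \<phi> p x.
    (\<lambda>K. (\<Sum>k<K. h (orbit m \<phi> x w k)) / real K) \<longlonglongrightarrow> (\<integral>z. h z \<partial>marginal 0 \<alpha>)"
proof -
  interpret prob_space \<alpha> by (rule prob_space_\<alpha>[OF \<alpha>_Prob])
  obtain \<rho> q \<delta> D where "contracting_random_maps (pow_space m) n (\<lambda>j. extension m (\<phi> j)) p \<rho> q 1 \<delta> D"
    and \<rho>: "\<And>x y. dist (x 0) (y 0) \<le> \<rho> x y"
    by (rule ex_contracting_distance) metis
  then interpret C: contracting_random_maps "pow_space m" n "\<lambda>j. extension m (\<phi> j)" p \<rho> q 1 \<delta> D by simp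
  let ?g = "\<lambda>y :: nat \<Rightarrow> 'a. h (y 0)"
  have "L-lipschitz_on UNIV h" using L by (intro lipschitz_onI) (auto simp: dist_real_def)
  then have h_meas: "h \<in> borel_measurable borel"
    by (intro borel_measurable_continuous_onI lipschitz_on_continuous_on)
  note coord = coordinate_measurable_\<alpha>[OF \<alpha>_Prob m]
  have g: "?g \<in> borel_measurable \<alpha>" using measurable_compose[OF coord h_meas] .
  have g1: "\<bar>?g y\<bar> \<le> 1" for y by (rule h)
  have g_lip: "\<bar>?g y - ?g z\<bar> \<le> L * \<rho> y z" for y z
    using L(2)[of "y 0" "z 0"] mult_left_mono[OF \<rho>[of y z] L(1)] by linarith
  define c where "c = (\<integral>y. ?g y \<partial>\<alpha>)"
  have c_eq: "c = (\<integral>z. h z \<partial>marginal 0 \<alpha>)"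
    unfolding c_def marginal_def by (rule integral_distr[OF coord h_meas, symmetric])
  have flat: "\<exists>N. \<forall>y\<in>pow_space m. \<bar>(avg_op ^^ N) ?g y - c\<bar> \<le> \<epsilon>" if \<epsilon>: "0 < \<epsilon>" for \<epsilon>
  proof -
    obtain N where N: "\<And>y z. \<lbrakk>y \<in> pow_space m; z \<in> pow_space m\<rbrakk> \<Longrightarrow> \<bar>(avg_op ^^ N) ?g y - (avg_op ^^ N) ?g z\<bar> \<le> \<epsilon>"
    proof (rule C.avg_op_iterates_flatten[of ?g 1 L \<epsilon>])
      show "\<bar>?g y\<bar> \<le> 1" for y by (rule g1)
      show "\<bar>?g y - ?g z\<bar> \<le> L * \<rho> y z" for y z by (rule g_lip)
    qed (use L(1) \<epsilon> that in auto)
    let ?u = "(avg_op ^^ N) ?g"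
    have "?u \<in> borel_measurable \<alpha> \<and> (\<integral>y. ?u y \<partial>\<alpha>) = (\<integral>y. ?g y \<partial>\<alpha>)"
      by (rule integral_avg_op_iterate[where G = 1, OF g]) (rule g1)
    then have u: "?u \<in> borel_measurable \<alpha>" and uc: "(\<integral>y. ?u y \<partial>\<alpha>) = c"
      by (simp_all add: c_def)
    have u1: "\<bar>?u y\<bar> \<le> 1" if "y \<in> pow_space m" for y
      by (rule avg_op_iterate_bounded[OF _ that]) (rule g1)
    have int: "integrable \<alpha> ?u"
      using u1 u by (intro integrable_const_bound[where B = 1] AE_I2) (auto simp: space_\<alpha>[OF \<alpha>_Prob])
    have "\<bar>?u y - c\<bar> \<le> \<epsilon>" if y: "y \<in> pow_space m" for y
    proof -
      have eq: "?u y - c = (\<integral>z. ?u y - ?u z \<partial>\<alpha>)" using int by (simp add: uc prob_space)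
      have "\<bar>?u y - c\<bar> \<le> (\<integral>z. \<bar>?u y - ?u z\<bar> \<partial>\<alpha>)"
        unfolding eq by (rule integral_abs_bound)
      also have "\<dots> \<le> (\<integral>z. \<epsilon> \<partial>\<alpha>)"
      proof (rule integral_mono)
        show "integrable \<alpha> (\<lambda>z. \<bar>?u y - ?u z\<bar>)"
          by (rule integrable_abs[OF Bochner_Integration.integrable_diff[OF integrable_const int]])
        show "\<bar>?u y - ?u z\<bar> \<le> \<epsilon>" if "z \<in> space \<alpha>" for z
          using that by (intro N y) (simp add: space_\<alpha>[OF \<alpha>_Prob])
      qed simp
      also have "\<dots> = \<epsilon>" by (simp add: prob_space)
      finally show ?thesis .
    qed
    then show ?thesis by blast
  qed
  have "AE w in code_measure m n \<phi> p x. (\<lambda>K. (\<Sum>k<K. ?g (chain x w k)) / real K) \<longlonglongrightarrow> c"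
    by (rule chain_averages_tendsto[OF x is_code_measure_code_measure[OF x] _ flat]) (rule g1)
  moreover have "?g (chain x w k) = h (orbit m \<phi> x w k)" for w k
    using m by (simp add: chain_eq_orbit_window[OF x] orbit_window_def)
  ultimately show ?thesis by (simp add: c_eq)
qed

end

end

theorem theorem24:
  fixes m n :: nat
    and \<phi> :: "nat \<Rightarrow> (nat \<Rightarrow> 'a::metric_space) \<Rightarrow> 'a"
    and p :: "nat \<Rightarrow> (nat \<Rightarrow> 'a) \<Rightarrow> real"
    and \<alpha> :: "(nat \<Rightarrow> 'a) measure"
  assumes "m \<ge> 2" and "n \<ge> 2"
    and "compact (UNIV :: 'a set)"
    and "gifspdp m n \<phi> p"
    and "E1 m n \<phi>"
    and "E2 m n p"
    and "extended_hutchinson_measure m n \<phi> p \<alpha>"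
  shows "(\<forall>k<m. \<forall>l<m. marginal k \<alpha> = marginal l \<alpha>) \<and>
    (\<forall>x\<in>pow_space m. \<exists>\<Omega>\<^sub>x\<in>sets (borel_of (code_topology n)).
       emeasure (code_measure m n \<phi> p x) \<Omega>\<^sub>x = 1 \<and>
       (\<forall>w\<in>\<Omega>\<^sub>x. \<forall>f :: 'a \<Rightarrow> real. continuous_on UNIV f \<longrightarrow>
          (\<lambda>K. (1 / real K) * (\<Sum>i<K. f (orbit m \<phi> x w i)))
            \<longlonglongrightarrow> (\<integral>y. f y \<partial>marginal 0 \<alpha>)))"
proof (intro conjI ballI)
  interpret contractive_gifspdp m n \<phi> p
    using assms by unfold_locales auto
  note hutchinson = assms(7)
  show "\<forall>k<m. \<forall>l<m. marginal k \<alpha> = marginal l \<alpha>"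
    using marginal_eq_marginal_0[OF hutchinson] by metis
  fix x :: "nat \<Rightarrow> 'a" assume x: "x \<in> pow_space m"
  let ?P = "code_measure m n \<phi> p x" and ?\<mu> = "marginal 0 \<alpha>"
  have P: "prob_space ?P" "sets ?P = sets (borel_of (code_topology n))"
    using is_code_measure_code_measure[OF x] by (auto simp: is_code_measure_def)
  have \<mu>: "prob_space ?\<mu>" "sets ?\<mu> = sets borel"
    using prob_space.prob_space_distr[OF prob_space_\<alpha> coordinate_measurable_\<alpha>, OF \<alpha>_Prob \<alpha>_Prob m] hutchinson
    by (simp_all add: marginal_def)
  show "\<exists>\<Omega>\<^sub>x\<in>sets (borel_of (code_topology n)). emeasure ?P \<Omega>\<^sub>x = 1 \<and>
      (\<forall>w\<in>\<Omega>\<^sub>x. \<forall>f :: 'a \<Rightarrow> real. continuous_on UNIV f \<longrightarrow>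
        (\<lambda>K. (1 / real K) * (\<Sum>i<K. f (orbit m \<phi> x w i))) \<longlonglongrightarrow> (\<integral>y. f y \<partial>?\<mu>))"
  proof (rule countable_lipschitz_test_functions[OF compact])
    fix \<H> :: "('a \<Rightarrow> real) set"
    assume \<H>: "countable \<H>" "\<And>h x. h \<in> \<H> \<Longrightarrow> \<bar>h x\<bar> \<le> 1"
      "\<And>h. h \<in> \<H> \<Longrightarrow> \<exists>L\<ge>0. \<forall>x y. \<bar>h x - h y\<bar> \<le> L * dist x y"
      and test: "\<And>(\<mu> :: 'a measure) a f. \<lbrakk>prob_space \<mu>; sets \<mu> = sets borel; continuous_on UNIV f;
          \<And>h. h \<in> \<H> \<Longrightarrow> (\<lambda>K. (\<Sum>k<K. h (a k)) / real K) \<longlonglongrightarrow> (\<integral>x. h x \<partial>\<mu>)\<rbrakk>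
        \<Longrightarrow> (\<lambda>K. (\<Sum>k<K. f (a k)) / real K) \<longlonglongrightarrow> (\<integral>x. (f x :: real) \<partial>\<mu>)"
    have "AE w in ?P. \<forall>h\<in>\<H>. (\<lambda>K. (\<Sum>k<K. h (orbit m \<phi> x w k)) / real K) \<longlonglongrightarrow> (\<integral>z. h z \<partial>?\<mu>)"
    proof (subst AE_ball_countable[OF \<H>(1)], intro ballI)
      fix h assume h: "h \<in> \<H>"
      then obtain L where "0 \<le> L" "\<And>z z'. \<bar>h z - h z'\<bar> \<le> L * dist z z'" using \<H>(3) by blast
      with \<H>(2)[OF h] show "AE w in ?P. (\<lambda>K. (\<Sum>k<K. h (orbit m \<phi> x w k)) / real K) \<longlonglongrightarrow> (\<integral>z. h z \<partial>?\<mu>)"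
        by (intro lipschitz_orbit_averages[OF hutchinson x])
    qed
    then obtain N where N: "N \<in> null_sets ?P"
      "{w \<in> space ?P. \<not> (\<forall>h\<in>\<H>. (\<lambda>K. (\<Sum>k<K. h (orbit m \<phi> x w k)) / real K) \<longlonglongrightarrow> (\<integral>z. h z \<partial>?\<mu>))} \<subseteq> N"
      unfolding eventually_ae_filter by blast
    show ?thesis
    proof (intro bexI[of _ "space ?P - N"] conjI ballI allI impI)
      show "space ?P - N \<in> sets (borel_of (code_topology n))"
        using N(1) unfolding P(2)[symmetric] by blast
      show "emeasure ?P (space ?P - N) = 1"
        using N(1) prob_space.emeasure_space_1[OF P(1)] by (simp add: emeasure_Diff_null_set)
      fix w and f :: "'a \<Rightarrow> real" assume w: "w \<in> space ?P - N" and f: "continuous_on UNIV f"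
      have "(\<lambda>K. (\<Sum>k<K. h (orbit m \<phi> x w k)) / real K) \<longlonglongrightarrow> (\<integral>z. h z \<partial>?\<mu>)" if "h \<in> \<H>" for h
        using w N(2) that by blast
      from test[OF \<mu> f this] show "(\<lambda>K. (1 / real K) * (\<Sum>i<K. f (orbit m \<phi> x w i))) \<longlonglongrightarrow> (\<integral>y. f y \<partial>?\<mu>)"
        by simp
    qed
  qed
qed

end
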